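(* Let $\mathbb{K}$ be a field of characteristic $p>0$, let $A=\mathbb{K}[x_1,\dots,x_n]$, let $\widehat{A}$ denote the completion of $A$ with respect to any prime ideal, and let $W$ be any multiplicatively closed subset of $A$. Then for every ideal $J\subseteq A$ and every $e$: (1) $I_e(J\otimes_A\widehat{A})=I_e(J)\otimes_A\widehat{A}$; (2) $W^{-1}I_e(J)=I_e(W^{-1}J)$.
   Context: For an ideal $L$ of a ring $R$ of characteristic $p$, $L^{[p^e]}$ is the ideal generated by $\{a^{p^e}\mid a\in L\}$. For an ideal $J\subseteq R$, $I_e(J)$ denotes the smallest ideal $L$ of $R$ such that $J\subseteq L^{[p^e]}$ (when it exists; it exists for all ideals in polynomial rings). By flatness, $J\otimes_A\widehat{A}$ is identified with the ideal $J\widehat{A}$ of $\widehat A$. In (1) $I_e$ on the left is taken in $\widehat{A}$, and in (2) $I_e$ on the right is taken in $W^{-1}A$. *)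

theory Defs
  imports
    "HOL-Library.Poly_Mapping"
    "HOL-Algebra.QuotRing"
    "HOL-Algebra.Ideal_Product"
begin

text \<open>
  The polynomial ring in the variables indexed by \<open>0, \<dots>, n - 1\<close>. A polynomial maps
  exponent vectors (finitely supported functions on \<open>nat\<close>) to coefficients; multiplication is
  the convolution product of \<^theory>\<open>HOL-Library.Poly_Mapping\<close>.
\<close>
definition mpoly_ring :: "nat \<Rightarrow> ((nat \<Rightarrow>\<^sub>0 nat) \<Rightarrow>\<^sub>0 'k::comm_ring_1) ring"
  where "mpoly_ring n =
    \<lparr>carrier = {f. \<forall>m\<in>Poly_Mapping.keys f. Poly_Mapping.keys m \<subseteq> {..<n}},
     mult = (*), one = 1, zero = 0, add = (+)\<rparr>"


definition frobenius_power :: "('a, 'b) ring_scheme \<Rightarrow> nat \<Rightarrow> 'a set \<Rightarrow> 'a set"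
  where "frobenius_power R q L = Idl\<^bsub>R\<^esub> {a [^]\<^bsub>R\<^esub> q | a. a \<in> L}"

definition is_I_e :: "('a, 'b) ring_scheme \<Rightarrow> nat \<Rightarrow> nat \<Rightarrow> 'a set \<Rightarrow> 'a set \<Rightarrow> bool"
  where "is_I_e R p e J L \<longleftrightarrow>
    ideal L R \<and> J \<subseteq> frobenius_power R (p ^ e) L \<and>
    (\<forall>L'. ideal L' R \<and> J \<subseteq> frobenius_power R (p ^ e) L' \<longrightarrow> L \<subseteq> L')"

text \<open>
  There is at most one \<open>L\<close> with \<open>is_I_e R p e J L\<close>. The term \<open>I_e R p e J\<close> is meaningful only if
  \<open>has_I_e R p e J\<close> holds.
\<close>
definition has_I_e :: "('a, 'b) ring_scheme \<Rightarrow> nat \<Rightarrow> nat \<Rightarrow> 'a set \<Rightarrow> bool"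
  where "has_I_e R p e J \<longleftrightarrow> (\<exists>L. is_I_e R p e J L)"

definition I_e :: "('a, 'b) ring_scheme \<Rightarrow> nat \<Rightarrow> nat \<Rightarrow> 'a set \<Rightarrow> 'a set"
  where "I_e R p e J = (THE L. is_I_e R p e J L)"


text \<open>
  The \<open>P\<close>-adic completion is the inverse limit of the rings \<open>R / P\<^sup>k\<close>. The transition map sends a
  coset of \<open>P\<^sup>k\<^sup>+\<^sup>1\<close> to the unique coset of \<open>P\<^sup>k\<close> that contains it, so a sequence of cosets is
  compatible iff it is decreasing.
\<close>
definition adic_quot :: "('a, 'b) ring_scheme \<Rightarrow> 'a set \<Rightarrow> nat \<Rightarrow> 'a set ring"
  where "adic_quot R P k = R Quot (P [^]\<^bsub>ideals_set R\<^esub> k)"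

definition adic_completion :: "('a, 'b) ring_scheme \<Rightarrow> 'a set \<Rightarrow> (nat \<Rightarrow> 'a set) ring"
  where "adic_completion R P =
    \<lparr>carrier = {s. (\<forall>k. s k \<in> carrier (adic_quot R P k)) \<and> (\<forall>k. s (Suc k) \<subseteq> s k)},
     mult = (\<lambda>s t k. s k \<otimes>\<^bsub>adic_quot R P k\<^esub> t k),
     one = (\<lambda>k. \<one>\<^bsub>adic_quot R P k\<^esub>),
     zero = (\<lambda>k. \<zero>\<^bsub>adic_quot R P k\<^esub>),
     add = (\<lambda>s t k. s k \<oplus>\<^bsub>adic_quot R P k\<^esub> t k)\<rparr>"

definition to_adic_completion :: "('a, 'b) ring_scheme \<Rightarrow> 'a set \<Rightarrow> 'a \<Rightarrow> nat \<Rightarrow> 'a set"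
  where "to_adic_completion R P a = (\<lambda>k. (P [^]\<^bsub>ideals_set R\<^esub> k) +>\<^bsub>R\<^esub> a)"

text \<open>The extended ideal, with which the base change of \<open>J\<close> to the completion is identified.\<close>
definition extend_to_completion :: "('a, 'b) ring_scheme \<Rightarrow> 'a set \<Rightarrow> 'a set \<Rightarrow> (nat \<Rightarrow> 'a set) set"
  where "extend_to_completion R P J =
    Idl\<^bsub>adic_completion R P\<^esub> (to_adic_completion R P ` J)"


text \<open>
  Localization at an arbitrary multiplicatively closed set, which may contain zero divisors and
  even zero. Fractions are equivalence classes of pairs (numerator, denominator).
\<close>
definition loc_rel :: "('a, 'b) ring_scheme \<Rightarrow> 'a set \<Rightarrow> (('a \<times> 'a) \<times> ('a \<times> 'a)) set"
  where "loc_rel R W = {((a, s), (b, t)). a \<in> carrier R \<and> s \<in> W \<and> b \<in> carrier R \<and> t \<in> W \<and>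
    (\<exists>u\<in>W. u \<otimes>\<^bsub>R\<^esub> (a \<otimes>\<^bsub>R\<^esub> t \<ominus>\<^bsub>R\<^esub> b \<otimes>\<^bsub>R\<^esub> s) = \<zero>\<^bsub>R\<^esub>)}"

definition loc_frac :: "('a, 'b) ring_scheme \<Rightarrow> 'a set \<Rightarrow> 'a \<Rightarrow> 'a \<Rightarrow> ('a \<times> 'a) set"
  where "loc_frac R W a s = loc_rel R W `` {(a, s)}"

text \<open>
  The unions below range over all representatives of the two classes; all of them give the same
  fraction.
\<close>
definition localization :: "('a, 'b) ring_scheme \<Rightarrow> 'a set \<Rightarrow> ('a \<times> 'a) set ring"
  where "localization R W =
    \<lparr>carrier = (carrier R \<times> W) // loc_rel R W,
     mult = (\<lambda>X Y. \<Union>(a, s)\<in>X. \<Union>(b, t)\<in>Y. loc_frac R W (a \<otimes>\<^bsub>R\<^esub> b) (s \<otimes>\<^bsub>R\<^esub> t)),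
     one = loc_frac R W \<one>\<^bsub>R\<^esub> \<one>\<^bsub>R\<^esub>,
     zero = loc_frac R W \<zero>\<^bsub>R\<^esub> \<one>\<^bsub>R\<^esub>,
     add = (\<lambda>X Y. \<Union>(a, s)\<in>X. \<Union>(b, t)\<in>Y.
              loc_frac R W (a \<otimes>\<^bsub>R\<^esub> t \<oplus>\<^bsub>R\<^esub> b \<otimes>\<^bsub>R\<^esub> s) (s \<otimes>\<^bsub>R\<^esub> t))\<rparr>"

definition localize_ideal :: "('a, 'b) ring_scheme \<Rightarrow> 'a set \<Rightarrow> 'a set \<Rightarrow> ('a \<times> 'a) set set"
  where "localize_ideal R W J = {loc_frac R W a s | a s. a \<in> J \<and> s \<in> W}"

end

theory Submission
  imports
    Defs
    "HOL-Algebra.Ring_Divisibility"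
    "HOL-Computational_Algebra.Primes"
begin

text \<open>
  Put \<open>q = p\<^sup>e\<close>. A Cartier map of a ring is an additive map \<open>\<psi>\<close> with \<open>\<psi> (a\<^sup>q b) = a \<psi> b\<close>; every such
  map carries \<open>L\<^bsup>[q]\<^esup>\<close> into \<open>L\<close>. The polynomial ring is free over its subring of \<open>q\<close>-th powers, so each
  \<open>f\<close> is a finite sum of terms \<open>\<psi>(f)\<^sup>q b\<close> for coordinate maps \<open>\<psi>\<close>, and therefore \<open>I\<^sub>e(J)\<close> is generated
  by the values of all Cartier maps on \<open>J\<close>.

  For the base changes it suffices that a polynomial \<open>f\<close> lying in \<open>L\<^bsup>[q]\<^esup>\<close>, for an ideal \<open>L\<close> of the
  larger ring, has \<open>\<psi> f\<close> in \<open>L\<close>. For a localization one clears denominators by a \<open>q\<close>-th power. For the completion,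
  \<open>P\<close> is finitely generated, so some \<open>P\<^sup>c\<close> lies in \<open>P\<^bsup>[q]\<^esup>\<close>; hence \<open>\<psi>\<close> carries \<open>P\<^bsup>ck\<^esup>\<close> into \<open>P\<^sup>k\<close>, is
  continuous for the adic topology and extends to a Cartier map of the completion.
\<close>

subsection \<open>Cartier maps\<close>

definition cartier_map :: "('a, 'b) ring_scheme \<Rightarrow> nat \<Rightarrow> ('a \<Rightarrow> 'a) \<Rightarrow> bool"
  where "cartier_map R q \<psi> \<longleftrightarrow>
    \<psi> \<in> carrier R \<rightarrow> carrier R \<and>
    (\<forall>a\<in>carrier R. \<forall>b\<in>carrier R. \<psi> (a \<oplus>\<^bsub>R\<^esub> b) = \<psi> a \<oplus>\<^bsub>R\<^esub> \<psi> b) \<and>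
    (\<forall>a\<in>carrier R. \<forall>b\<in>carrier R. \<psi> (a [^]\<^bsub>R\<^esub> q \<otimes>\<^bsub>R\<^esub> b) = a \<otimes>\<^bsub>R\<^esub> \<psi> b)"

definition cartier_ideal :: "('a, 'b) ring_scheme \<Rightarrow> nat \<Rightarrow> 'a set \<Rightarrow> 'a set"
  where "cartier_ideal R q J = Idl\<^bsub>R\<^esub> {\<psi> x | \<psi> x. cartier_map R q \<psi> \<and> x \<in> J}"

lemma cartier_mapD:
  assumes "cartier_map R q \<psi>"
  shows "a \<in> carrier R \<Longrightarrow> \<psi> a \<in> carrier R"
    and "a \<in> carrier R \<Longrightarrow> b \<in> carrier R \<Longrightarrow> \<psi> (a \<oplus>\<^bsub>R\<^esub> b) = \<psi> a \<oplus>\<^bsub>R\<^esub> \<psi> b"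
    and "a \<in> carrier R \<Longrightarrow> b \<in> carrier R \<Longrightarrow> \<psi> (a [^]\<^bsub>R\<^esub> q \<otimes>\<^bsub>R\<^esub> b) = a \<otimes>\<^bsub>R\<^esub> \<psi> b"
  using assms by (auto simp: cartier_map_def)

lemma (in cring) cring_idealI:
  assumes "I \<subseteq> carrier R" "\<zero> \<in> I"
    and add: "\<And>a b. a \<in> I \<Longrightarrow> b \<in> I \<Longrightarrow> a \<oplus> b \<in> I"
    and mult: "\<And>r a. r \<in> carrier R \<Longrightarrow> a \<in> I \<Longrightarrow> r \<otimes> a \<in> I"
  shows "ideal I R"
proof (rule idealI)
  show "subgroup I (add_monoid R)"
  proof (rule add.subgroupI)
    fix a assume a: "a \<in> I"
    then have "\<ominus> a = (\<ominus> \<one>) \<otimes> a"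
      using assms(1) by (simp add: l_minus subsetD)
    with a mult[of "\<ominus> \<one>" a] show "\<ominus> a \<in> I" by simp
  qed (use assms in auto)
next
  show "a \<otimes> x \<in> I" "x \<otimes> a \<in> I" if "a \<in> I" "x \<in> carrier R" for a x
    using mult[OF that(2,1)] m_comm[OF that(2), of a] assms(1) that by auto
qed (rule ring_axioms)

context cring
begin

lemma frobenius_power_gens: "ideal L R \<Longrightarrow> {a [^] (q::nat) | a. a \<in> L} \<subseteq> carrier R"
  by (auto dest: ideal.Icarr)

lemma frobenius_power_ideal: "ideal L R \<Longrightarrow> ideal (frobenius_power R q L) R"
  unfolding frobenius_power_def by (intro genideal_ideal frobenius_power_gens)

lemma pow_in_frobenius_power: "ideal L R \<Longrightarrow> a \<in> L \<Longrightarrow> a [^] q \<in> frobenius_power R q L"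
  unfolding frobenius_power_def using genideal_self[OF frobenius_power_gens] by blast

lemma frobenius_power_minimal:
  assumes "ideal K R" "\<And>a. a \<in> L \<Longrightarrow> a [^] q \<in> K"
  shows "frobenius_power R q L \<subseteq> K"
  unfolding frobenius_power_def using assms by (intro genideal_minimal) auto

lemma cartier_zero:
  assumes "cartier_map R q \<psi>" shows "\<psi> \<zero> = \<zero>"
  using cartier_mapD(1)[OF assms, of \<zero>] cartier_mapD(2)[OF assms, of \<zero> \<zero>] add.l_cancel_one by simp

lemma cartier_minus:
  assumes \<psi>: "cartier_map R q \<psi>" and a: "a \<in> carrier R" and b: "b \<in> carrier R"
  shows "\<psi> (a \<ominus> b) = \<psi> a \<ominus> \<psi> b"
proof -
  have "\<psi> a = \<psi> (a \<ominus> b) \<oplus> \<psi> b"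
    using cartier_mapD(2)[OF \<psi>, of "a \<ominus> b" b] a b by (simp add: a_minus_def a_assoc l_neg)
  then show ?thesis
    using cartier_mapD(1)[OF \<psi>] a b by (simp add: a_minus_def a_assoc r_neg)
qed

text \<open>As \<psi> is not \<open>R\<close>-linear, the set where it takes values in
  \<open>L\<close> need not be an ideal; \<open>K\<close> is the largest ideal inside that set. So
  it suffices to test generators, and \<open>\<psi> (r a^q) = a \<psi> r\<close> lies in
  \<open>L\<close> for \<open>a\<close> in \<open>L\<close>.\<close>

lemma cartier_frobenius_power:
  assumes \<psi>: "cartier_map R q \<psi>" and L: "ideal L R" and x: "x \<in> frobenius_power R q L"
  shows "\<psi> x \<in> L"
proof -
  interpret L: ideal L R by fact
  define K where "K = {x \<in> carrier R. \<forall>r\<in>carrier R. \<psi> (r \<otimes> x) \<in> L}"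
  have "ideal K R"
  proof (rule cring_idealI)
    show "K \<subseteq> carrier R" "\<zero> \<in> K"
      by (auto simp: K_def cartier_zero[OF \<psi>])
    show "a \<oplus> b \<in> K" if "a \<in> K" "b \<in> K" for a b
      using that by (auto simp: K_def r_distr cartier_mapD[OF \<psi>])
    show "s \<otimes> a \<in> K" if "s \<in> carrier R" "a \<in> K" for s a
      using that by (auto simp: K_def m_assoc[symmetric])
  qed
  moreover have "a [^] q \<in> K" if "a \<in> L" for a
    unfolding K_def using that cartier_mapD[OF \<psi>]
    by (auto simp: m_comm[of _ "a [^] q"] L.I_r_closed)
  ultimately have "x \<in> K"
    using frobenius_power_minimal x by blast
  then have "\<psi> (\<one> \<otimes> x) \<in> L" "x \<in> carrier R" unfolding K_def by blast+
  then show ?thesis by simp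
qed

lemma cartier_ideal_gens:
  "ideal J R \<Longrightarrow> {\<psi> x | \<psi> x. cartier_map R q \<psi> \<and> x \<in> J} \<subseteq> carrier R"
  by (auto dest: cartier_mapD(1) ideal.Icarr)

lemma cartier_ideal_ideal: "ideal J R \<Longrightarrow> ideal (cartier_ideal R q J) R"
  unfolding cartier_ideal_def by (intro genideal_ideal cartier_ideal_gens)

lemma cartier_in_cartier_ideal:
  "ideal J R \<Longrightarrow> cartier_map R q \<psi> \<Longrightarrow> x \<in> J \<Longrightarrow> \<psi> x \<in> cartier_ideal R q J"
  unfolding cartier_ideal_def using genideal_self[OF cartier_ideal_gens] by blast

lemma cartier_ideal_minimal:
  "ideal K R \<Longrightarrow> (\<And>\<psi> x. cartier_map R q \<psi> \<Longrightarrow> x \<in> J \<Longrightarrow> \<psi> x \<in> K) \<Longrightarrow> cartier_ideal R q J \<subseteq> K"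
  unfolding cartier_ideal_def by (intro genideal_minimal) auto

end

section \<open>Base change of \<open>I_e\<close> along a ring homomorphism\<close>

lemma (in ring_hom_ring) ideal_vimage:
  assumes "ideal L S" shows "ideal {x \<in> carrier R. h x \<in> L} R"
proof -
  interpret L: ideal L S by fact
  show ?thesis
    by (rule idealI)
      (auto simp: R.ring_axioms L.I_l_closed L.I_r_closed a_inv_def[symmetric] intro!: R.add.subgroupI)
qed

lemma I_eI:
  assumes "is_I_e R p e J L" shows "has_I_e R p e J" "I_e R p e J = L"
  using assms unfolding has_I_e_def I_e_def is_I_e_def by (blast, intro the_equality) blast+

text \<open>This isolates the two facts behind every base change. By \<open>split\<close>,
  \<open>J\<close> lies in the Frobenius power of the Cartier ideal, and contraction along
  \<open>h\<close> carries this over to \<open>S\<close>. By \<open>descent\<close>, an admissible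
  ideal \<open>L\<close> of \<open>S\<close> contains the images of all values
  \<open>\<psi> x\<close>, so its contraction contains the Cartier ideal; this is
  minimality.\<close>

lemma is_I_e_base_change:
  assumes "ring_hom_cring R S h" and J: "ideal J R"
    and split: "\<And>x. x \<in> J \<Longrightarrow> x \<in> frobenius_power R (p ^ e) (cartier_ideal R (p ^ e) J)"
    and descent: "\<And>\<psi> L x. cartier_map R (p ^ e) \<psi> \<Longrightarrow> ideal L S \<Longrightarrow> x \<in> carrier R \<Longrightarrow>
      h x \<in> frobenius_power S (p ^ e) L \<Longrightarrow> h (\<psi> x) \<in> L"
  shows "is_I_e S p e (Idl\<^bsub>S\<^esub> (h ` J)) (Idl\<^bsub>S\<^esub> (h ` cartier_ideal R (p ^ e) J))"
proof -
  interpret ring_hom_cring R S h by fact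
  have hom: "ring_hom_ring R S h" ..
  let ?q = "p ^ e" and ?I = "cartier_ideal R (p ^ e) J"
  let ?SI = "Idl\<^bsub>S\<^esub> (h ` ?I)"
  have I: "ideal ?I R" by (rule R.cartier_ideal_ideal[OF J])
  have carr: "h ` J \<subseteq> carrier S" "h ` ?I \<subseteq> carrier S"
    using ideal.Icarr[OF J] ideal.Icarr[OF I] by auto
  have SI: "ideal ?SI S" by (rule S.genideal_ideal[OF carr(2)])
  have "frobenius_power R ?q ?I \<subseteq> {x \<in> carrier R. h x \<in> frobenius_power S ?q ?SI}"
  proof (rule R.frobenius_power_minimal)
    show "ideal {x \<in> carrier R. h x \<in> frobenius_power S ?q ?SI} R"
      by (intro ring_hom_ring.ideal_vimage[OF hom] S.frobenius_power_ideal SI)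
    show "a [^]\<^bsub>R\<^esub> ?q \<in> {x \<in> carrier R. h x \<in> frobenius_power S ?q ?SI}" if "a \<in> ?I" for a
      using that ideal.Icarr[OF I that] S.genideal_self[OF carr(2)] S.pow_in_frobenius_power[OF SI, of "h a" ?q]
      by (auto simp: ring_hom_ring.hom_nat_pow[OF hom])
  qed
  then have "Idl\<^bsub>S\<^esub> (h ` J) \<subseteq> frobenius_power S ?q ?SI"
    using split by (intro S.genideal_minimal S.frobenius_power_ideal SI) blast
  moreover have "?SI \<subseteq> L" if L: "ideal L S" and sub: "Idl\<^bsub>S\<^esub> (h ` J) \<subseteq> frobenius_power S ?q L" for L
  proof -
    have "?I \<subseteq> {x \<in> carrier R. h x \<in> L}"
    proof (rule R.cartier_ideal_minimal[OF ring_hom_ring.ideal_vimage[OF hom L]])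
      fix \<psi> x assume *: "cartier_map R ?q \<psi>" "x \<in> J"
      then have "h x \<in> frobenius_power S ?q L"
        using S.genideal_self[OF carr(1)] sub by blast
      with * show "\<psi> x \<in> {x \<in> carrier R. h x \<in> L}"
        using descent[OF _ L] cartier_mapD(1) ideal.Icarr[OF J] by fastforce
    qed
    then show ?thesis by (intro S.genideal_minimal L) blast
  qed
  ultimately show ?thesis using SI unfolding is_I_e_def by blast
qed

text \<open>The case of the identity map, where descent is
  \<open>cartier_frobenius_power\<close>.\<close>

lemma (in cring) is_I_e_cartier_ideal:
  assumes J: "ideal J R"
    and split: "\<And>x. x \<in> J \<Longrightarrow> x \<in> frobenius_power R (p ^ e) (cartier_ideal R (p ^ e) J)"
  shows "is_I_e R p e J (cartier_ideal R (p ^ e) J)"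
proof -
  have Idl: "Idl K = K" if "ideal K R" for K
    using genideal_minimal[OF that order_refl] genideal_self[of K] ideal.Icarr[OF that] by blast
  have "ring_hom_cring R R (\<lambda>x. x)"
    by (intro ring_hom_cring.intro ring_hom_cring_axioms.intro is_cring ring_hom_memI) simp_all
  from is_I_e_base_change[OF this J split] show ?thesis
    by (simp add: Idl J cartier_ideal_ideal cartier_frobenius_power)
qed

subsection \<open>Powers of a finitely generated ideal\<close>

context cring
begin

abbreviation ideal_pow :: "'a set \<Rightarrow> nat \<Rightarrow> 'a set"
  where "ideal_pow P k \<equiv> P [^]\<^bsub>ideals_set R\<^esub> k"

lemma ideal_pow_ideal: "ideal P R \<Longrightarrow> ideal (ideal_pow P k) R"
  using monoid.nat_pow_closed[OF comm_monoid.axioms(1)[OF ideals_set_is_comm_monoid], of P k]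
  by (simp add: ideals_set_def)

lemma ideal_pow_0: "ideal_pow P 0 = carrier R"
  by (simp add: ideals_set_def nat_pow_def)

lemma ideal_pow_Suc: "ideal_pow P (Suc k) = ideal_pow P k \<cdot> P"
  by (simp add: nat_pow_def) (simp add: ideals_set_def)

lemma ideal_pow_mult: "ideal P R \<Longrightarrow> ideal_pow P (k * l) = ideal_pow (ideal_pow P k) l"
  using monoid.nat_pow_pow[OF comm_monoid.axioms(1)[OF ideals_set_is_comm_monoid], of P k l]
  by (simp add: ideals_set_def)

lemma ideal_pow_Suc_subset: "ideal P R \<Longrightarrow> ideal_pow P (Suc k) \<subseteq> ideal_pow P k"
  unfolding ideal_pow_Suc using ideal_prod_inter[OF ideal_pow_ideal[of P k]] by blast

lemma ideal_prod_subset: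
  assumes "ideal K R" "\<And>a b. a \<in> I \<Longrightarrow> b \<in> J \<Longrightarrow> a \<otimes> b \<in> K"
  shows "I \<cdot> J \<subseteq> K"
proof
  fix x assume "x \<in> I \<cdot> J"
  then show "x \<in> K"
    by induction (use assms in \<open>auto intro: additive_subgroup.a_closed[OF ideal.axioms(1)]\<close>)
qed

text \<open>
  With \<open>I\<close> generated by \<open>Y\<close> and \<open>M = I + (y)\<close>, one has \<open>M\<^sup>q \<subseteq> I + (y\<^sup>q) \<subseteq> I + Q\<close>, and the powers of
  \<open>I + Q\<close> lie in the corresponding powers of \<open>I\<close> up to \<open>Q\<close>.
\<close>

lemma ideal_pow_subset_of_generators:
  fixes q :: nat
  assumes "finite Y" "Y \<subseteq> carrier R" and Q: "ideal Q R"
    and "\<And>y. y \<in> Y \<Longrightarrow> y [^] q \<in> Q"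
  shows "\<exists>c. ideal_pow (Idl Y) c \<subseteq> Q"
  using assms(1,2,4)
proof (induction Y)
  case empty
  have "Idl {} = {\<zero>}"
    using genideal_minimal[OF zeroideal, of "{}"] additive_subgroup.zero_closed[OF ideal.axioms(1)[OF genideal_ideal[of "{}"]]]
    by auto
  \<comment> \<open>The exponent is 1 because the power with exponent 0 is the whole ring.\<close>
  then have "ideal_pow (Idl {}) (Suc 0) \<subseteq> {\<zero>}"
    using ideal_prod_inter[OF oneideal zeroideal] unfolding ideal_pow_Suc ideal_pow_0 by auto
  also have "\<dots> \<subseteq> Q"
    using additive_subgroup.zero_closed[OF ideal.axioms(1)[OF Q]] by auto
  finally have "ideal_pow (Idl {}) (Suc 0) \<subseteq> Q" .
  then show ?case ..
next
  case (insert y Y)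
  interpret Q: ideal Q R by fact
  have y: "y \<in> carrier R" and Y: "Y \<subseteq> carrier R" and yq: "y [^] q \<in> Q" using insert.prems by auto
  obtain c where c: "ideal_pow (Idl Y) c \<subseteq> Q" using insert by auto
  define I where "I = Idl Y"
  interpret I: ideal I R unfolding I_def by (rule genideal_ideal[OF Y])
  define M where "M = Idl (insert y Y)"
  have M: "ideal M R" unfolding M_def using y Y by (intro genideal_ideal) auto
  have addI: "\<exists>i\<in>I. \<exists>j\<in>J. a = i \<oplus> j" if "a \<in> I <+> J" for a :: 'a and I J
    using that by (auto simp: set_add_def')
  have memI: "i \<oplus> j \<in> I <+> J" if "i \<in> I" "j \<in> J" for i j :: 'a and I J
    using that by (auto simp: set_add_def')
  have pid: "ideal (PIdl (y [^] j)) R" for j :: nat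
    using y by (intro cgenideal_ideal) auto
  have MI: "\<exists>i\<in>I. \<exists>r\<in>carrier R. m = i \<oplus> r \<otimes> y" if "m \<in> M" for m
  proof -
    have "M \<subseteq> I <+> PIdl (y [^] (1::nat))"
      unfolding M_def
    proof (rule genideal_minimal)
      show "ideal (I <+> PIdl (y [^] (1::nat))) R" by (intro add_ideals pid I.is_ideal)
      have "y \<in> PIdl y" by (rule cgenideal_self[OF y])
      then have "\<zero> \<oplus> y \<in> I <+> PIdl y" by (intro memI) auto
      moreover have "z \<oplus> \<zero> \<in> I <+> PIdl y" if "z \<in> Y" for z
        using that genideal_self[OF Y] y
        by (intro memI) (auto simp: I_def cgenideal_def intro!: exI[of _ \<zero>])
      ultimately show "insert y Y \<subseteq> I <+> PIdl (y [^] (1::nat))"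
        using y Y by (auto simp: subset_iff)
    qed
    with that have "m \<in> I <+> PIdl (y [^] (1::nat))" by blast
    from addI[OF this] show ?thesis using y by (auto simp: cgenideal_def)
  qed
  have A: "ideal_pow M j \<subseteq> I <+> PIdl (y [^] j)" for j
  proof (induction j)
    case 0
    have "\<zero> \<oplus> x \<in> I <+> PIdl (y [^] (0::nat))" if "x \<in> carrier R" for x
      using that by (intro memI) (auto simp: cgenideal_def intro!: exI[of _ x])
    then show ?case unfolding ideal_pow_0 by auto
  next
    case (Suc j)
    show ?case unfolding ideal_pow_Suc
    proof (rule ideal_prod_subset)
      show "ideal (I <+> PIdl (y [^] Suc j)) R" by (intro add_ideals pid I.is_ideal)
      fix a b assume "a \<in> ideal_pow M j" "b \<in> M"
      then have "a \<in> I <+> PIdl (y [^] j)" using Suc by blast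
      from addI[OF this] obtain i r where a: "i \<in> I" "r \<in> carrier R" "a = i \<oplus> r \<otimes> y [^] j"
        by (auto simp: cgenideal_def)
      from MI[OF \<open>b \<in> M\<close>] obtain i' r' where b: "i' \<in> I" "r' \<in> carrier R" "b = i' \<oplus> r' \<otimes> y" by auto
      have ic: "i \<in> carrier R" "i' \<in> carrier R" using a b I.Icarr by auto
      \<comment> \<open>Every term of the product except \<open>r r' y^(j + 1)\<close> carries a
        factor \<open>i\<close> or \<open>i'\<close> and so lies in \<open>I\<close>.\<close>
      have "a \<otimes> b = (i \<otimes> b \<oplus> (r \<otimes> y [^] j) \<otimes> i') \<oplus> (r \<otimes> r') \<otimes> y [^] Suc j"
        unfolding a(3) b(3) using a(2) b(2) ic y nat_pow_closed[OF y, of j] 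
        by (simp only: nat_pow_Suc) algebra
      moreover have "i \<otimes> b \<oplus> (r \<otimes> y [^] j) \<otimes> i' \<in> I"
        using a b ic y by (intro I.a_closed I.I_r_closed I.I_l_closed) auto
      moreover have "(r \<otimes> r') \<otimes> y [^] Suc j \<in> PIdl (y [^] Suc j)"
        unfolding cgenideal_def using a b by blast
      ultimately show "a \<otimes> b \<in> I <+> PIdl (y [^] Suc j)" using memI by auto
    qed
  qed
  have B: "ideal_pow (ideal_pow M q) k \<subseteq> ideal_pow I k <+> Q" for k
  proof (induction k)
    case 0
    have "x \<oplus> \<zero> \<in> ideal_pow I 0 <+> Q" if "x \<in> carrier R" for x
      using that unfolding ideal_pow_0 by (intro memI) auto
    then show ?case unfolding ideal_pow_0 by auto
  next
    case (Suc k)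
    interpret Ik: ideal "ideal_pow I k" R by (intro ideal_pow_ideal I.is_ideal)
    show ?case unfolding ideal_pow_Suc
    proof (rule ideal_prod_subset)
      show "ideal (ideal_pow I k \<cdot> I <+> Q) R"
        by (intro add_ideals ideal_prod_is_ideal Ik.is_ideal I.is_ideal Q)
      fix a b assume ab: "a \<in> ideal_pow (ideal_pow M q) k" "b \<in> ideal_pow M q"
      then have "a \<in> ideal_pow I k <+> Q" using Suc by blast
      from addI[OF this] obtain i s where a: "i \<in> ideal_pow I k" "s \<in> Q" "a = i \<oplus> s" by auto
      have "b \<in> I <+> PIdl (y [^] q)" using A ab by blast
      from addI[OF this] obtain j r where b: "j \<in> I" "r \<in> carrier R" "b = j \<oplus> r \<otimes> y [^] q"
        by (auto simp: cgenideal_def)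
      have carr: "i \<in> carrier R" "s \<in> carrier R" "j \<in> carrier R" "y [^] q \<in> carrier R"
        using a b Ik.Icarr Q.Icarr I.Icarr y by auto
      have "a \<otimes> b = i \<otimes> j \<oplus> (s \<otimes> b \<oplus> (i \<otimes> r) \<otimes> y [^] q)"
        unfolding a(3) b(3) using carr b(2) by algebra
      moreover have "s \<otimes> b \<oplus> (i \<otimes> r) \<otimes> y [^] q \<in> Q"
        using a b carr yq by (intro Q.a_closed Q.I_r_closed Q.I_l_closed) auto
      moreover have "i \<otimes> j \<in> ideal_pow I k \<cdot> I" using a b by (intro ideal_prod.prod)
      ultimately show "a \<otimes> b \<in> ideal_pow I k \<cdot> I <+> Q" using memI by auto
    qed
  qed
  \<comment> \<open>\<open>M^(q c) = (M^q)^c\<close> lies in \<open>I^c + Q\<close>, and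
    \<open>I^c\<close> lies in \<open>Q\<close> by the choice of \<open>c\<close>.\<close>
  have "ideal_pow M (q * c) \<subseteq> Q"
  proof
    fix x assume "x \<in> ideal_pow M (q * c)"
    then have "x \<in> ideal_pow I c <+> Q" using B ideal_pow_mult[OF M] by blast
    from addI[OF this] show "x \<in> Q" using c unfolding I_def by auto
  qed
  then show ?case unfolding M_def by blast
qed

text \<open>Induction on \<open>k\<close>: \<open>P^(c (k + 1))\<close> lies in the product of
  \<open>P^(c k)\<close> with the Frobenius power of \<open>P\<close>, and
  \<open>\<psi> (r b a^q) = a \<psi> (r b)\<close> lies in \<open>P^(k + 1)\<close> for
  \<open>b\<close> in \<open>P^(c k)\<close> and \<open>a\<close> in \<open>P\<close>.\<close>

lemma cartier_ideal_pow:
  assumes \<psi>: "cartier_map R q \<psi>" and P: "ideal P R"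
    and c: "ideal_pow P c \<subseteq> frobenius_power R q P"
  shows "x \<in> ideal_pow P (c * k) \<Longrightarrow> \<psi> x \<in> ideal_pow P k"
proof (induction k arbitrary: x)
  case 0
  then show ?case using cartier_mapD(1)[OF \<psi>] unfolding mult_0_right ideal_pow_0 by simp
next
  case (Suc k)
  define N where "N = ideal_pow P (Suc k)"
  interpret N: ideal N R unfolding N_def by (rule ideal_pow_ideal[OF P])
  interpret Pk: ideal "ideal_pow P (c * k)" R by (rule ideal_pow_ideal[OF P])
  interpret P: ideal P R by (rule P)
  define K where "K = {z \<in> carrier R. \<forall>r\<in>carrier R. \<psi> (r \<otimes> z) \<in> N}"
  have K: "ideal K R"
  proof (rule cring_idealI)
    show "K \<subseteq> carrier R" "\<zero> \<in> K"
      by (auto simp: K_def cartier_zero[OF \<psi>])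
    show "a \<oplus> b \<in> K" if "a \<in> K" "b \<in> K" for a b
      using that by (auto simp: K_def r_distr cartier_mapD[OF \<psi>])
    show "s \<otimes> a \<in> K" if "s \<in> carrier R" "a \<in> K" for s a
      using that by (auto simp: K_def m_assoc[symmetric])
  qed
  \<comment> \<open>Quantifying over the multipliers \<open>b\<close>, and over \<open>r\<close>
    inside \<open>K\<close>, turns both sets into ideals, so that only the powers \<open>a^q\<close>
    have to be checked.\<close>
  have frob: "frobenius_power R q P \<subseteq> {z \<in> carrier R. \<forall>b\<in>ideal_pow P (c * k). b \<otimes> z \<in> K}"
  proof (rule frobenius_power_minimal)
    show "ideal {z \<in> carrier R. \<forall>b\<in>ideal_pow P (c * k). b \<otimes> z \<in> K} R"
    proof (rule cring_idealI)
      show "b \<oplus> d \<in> {z \<in> carrier R. \<forall>b\<in>ideal_pow P (c * k). b \<otimes> z \<in> K}"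
        if "b \<in> {z \<in> carrier R. \<forall>b\<in>ideal_pow P (c * k). b \<otimes> z \<in> K}"
          "d \<in> {z \<in> carrier R. \<forall>b\<in>ideal_pow P (c * k). b \<otimes> z \<in> K}" for b d
        using that by (auto simp: r_distr intro: additive_subgroup.a_closed[OF ideal.axioms(1)[OF K]])
      show "r \<otimes> a \<in> {z \<in> carrier R. \<forall>b\<in>ideal_pow P (c * k). b \<otimes> z \<in> K}"
        if "r \<in> carrier R" "a \<in> {z \<in> carrier R. \<forall>b\<in>ideal_pow P (c * k). b \<otimes> z \<in> K}" for r a
        using that by (auto simp: m_lcomm[OF Pk.Icarr that(1)] intro: ideal.I_l_closed[OF K])
    qed (auto intro: additive_subgroup.zero_closed[OF ideal.axioms(1)[OF K]])
    fix a assume a: "a \<in> P"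
    have "\<psi> (r \<otimes> (b \<otimes> a [^] q)) \<in> N" if "b \<in> ideal_pow P (c * k)" "r \<in> carrier R" for b r
    proof -
      have "r \<otimes> (b \<otimes> a [^] q) = a [^] q \<otimes> (r \<otimes> b)"
        using that a by (simp add: m_ac)
      moreover have "\<psi> (r \<otimes> b) \<in> ideal_pow P k"
        using that by (intro Suc.IH Pk.I_l_closed) auto
      then have "\<psi> (r \<otimes> b) \<otimes> a \<in> N"
        unfolding N_def ideal_pow_Suc using a by (intro ideal_prod.prod)
      ultimately show ?thesis
        using cartier_mapD[OF \<psi>, of a] cartier_mapD(1)[OF \<psi>, of "r \<otimes> b"] a that
        by (simp add: cartier_mapD[OF \<psi>] m_comm)
    qed
    then show "a [^] q \<in> {z \<in> carrier R. \<forall>b\<in>ideal_pow P (c * k). b \<otimes> z \<in> K}"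
      using a by (auto simp: K_def)
  qed
  have "ideal_pow P (c * Suc k) = ideal_pow P (c * k) \<cdot> ideal_pow P c"
    using monoid.nat_pow_mult[OF comm_monoid.axioms(1)[OF ideals_set_is_comm_monoid], of P "c * k" c] P
    by (simp add: ideals_set_def add.commute)
  also have "\<dots> \<subseteq> K"
    using frob c by (intro ideal_prod_subset K) blast
  finally have "x \<in> K" using Suc.prems by blast
  then have "\<psi> (\<one> \<otimes> x) \<in> N" "x \<in> carrier R" unfolding K_def by blast+
  then show ?case by (simp add: N_def)
qed

end

subsection \<open>The adic completion\<close>

context ideal
begin

text \<open>Any element of a coset represents it. The completion is therefore handled through
  members of cosets: sums, products and compatibility are verified on them.\<close>

lemma rcoset_memD:
  assumes "X \<in> carrier (R Quot I)" "a \<in> X"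
  shows "a \<in> carrier R" "X = I +> a"
proof -
  obtain x where x: "x \<in> carrier R" "X = I +> x"
    using assms(1) by (auto simp: FactRing_simps)
  show "a \<in> carrier R" using assms x a_r_coset_subset_G[OF a_subset] by blast
  show "X = I +> a" using assms(2) x a_repr_independence[OF _ _ a_subgroup] by blast
qed

lemma rcoset_in_Quot: "a \<in> carrier R \<Longrightarrow> I +> a \<in> carrier (R Quot I)"
  by (auto simp: FactRing_simps)

lemma rcoset_nonempty: "X \<in> carrier (R Quot I) \<Longrightarrow> \<exists>a. a \<in> X"
  by (auto simp: FactRing_simps intro: a_rcos_self)

lemma rcoset_mem_add:
  assumes "X \<in> carrier (R Quot I)" "Y \<in> carrier (R Quot I)" "a \<in> X" "b \<in> Y"
  shows "a \<oplus> b \<in> X \<oplus>\<^bsub>R Quot I\<^esub> Y"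
  using rcoset_memD[OF assms(1,3)] rcoset_memD[OF assms(2,4)]
  by (simp add: FactRing_def a_rcos_sum a_rcos_self)

lemma rcoset_mem_mult:
  assumes "X \<in> carrier (R Quot I)" "Y \<in> carrier (R Quot I)" "a \<in> X" "b \<in> Y"
  shows "a \<otimes> b \<in> X \<otimes>\<^bsub>R Quot I\<^esub> Y"
  using rcoset_memD[OF assms(1,3)] rcoset_memD[OF assms(2,4)]
  by (simp add: FactRing_def rcoset_mult_add a_rcos_self)

lemma rcoset_mem_minus:
  assumes "X \<in> carrier (R Quot I)" "a \<in> X"
  shows "\<ominus> a \<in> \<ominus>\<^bsub>R Quot I\<^esub> X"
proof -
  interpret h: ring_hom_ring R "R Quot I" "(+>) I" by (rule rcos_ring_hom_ring)
  have "\<ominus>\<^bsub>R Quot I\<^esub> X = I +> (\<ominus> a)"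
    using rcoset_memD[OF assms] h.hom_a_inv[of a] by simp
  then show ?thesis using a_rcos_self[of "\<ominus> a"] rcoset_memD(1)[OF assms] by simp
qed

end

locale adic_ring = cring R + P: ideal P R for R (structure) and P
begin

abbreviation C where "C \<equiv> adic_completion R P"

sublocale pow: ideal "ideal_pow P k" R for k
  by (rule ideal_pow_ideal[OF P.is_ideal])

sublocale quot: cring "adic_quot R P k" for k
  unfolding adic_quot_def by (rule pow.quotient_is_cring[OF is_cring])

lemma C_carrier: "s \<in> carrier C \<Longrightarrow> s k \<in> carrier (adic_quot R P k)"
  by (simp add: adic_completion_def)

lemma C_ops:
  "(s \<otimes>\<^bsub>C\<^esub> t) k = s k \<otimes>\<^bsub>adic_quot R P k\<^esub> t k"
  "(s \<oplus>\<^bsub>C\<^esub> t) k = s k \<oplus>\<^bsub>adic_quot R P k\<^esub> t k"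
  "\<one>\<^bsub>C\<^esub> k = \<one>\<^bsub>adic_quot R P k\<^esub>"
  "\<zero>\<^bsub>C\<^esub> k = \<zero>\<^bsub>adic_quot R P k\<^esub>"
  by (simp_all add: adic_completion_def)

lemma C_memD: "s \<in> carrier C \<Longrightarrow> a \<in> s k \<Longrightarrow> a \<in> carrier R \<and> s k = ideal_pow P k +> a"
  using pow.rcoset_memD[of "s k" k a] C_carrier[of s k] by (simp add: adic_quot_def)

lemma C_nonempty: "s \<in> carrier C \<Longrightarrow> \<exists>a. a \<in> s k"
  using pow.rcoset_nonempty[of "s k" k] C_carrier[of s k] by (simp add: adic_quot_def)

lemma C_antimono: "s \<in> carrier C \<Longrightarrow> k \<le> l \<Longrightarrow> s l \<subseteq> s k"
  by (rule lift_Suc_antimono_le[of s]) (simp_all add: adic_completion_def)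

text \<open>One common element forces compatibility: both cosets are translates by it, and
  \<open>P^(k + 1)\<close> lies in \<open>P^k\<close>.\<close>

lemma C_I:
  assumes "\<And>k. s k \<in> carrier (adic_quot R P k)" "\<And>k. \<exists>a. a \<in> s (Suc k) \<and> a \<in> s k"
  shows "s \<in> carrier C"
proof -
  have "s (Suc k) \<subseteq> s k" for k
  proof -
    obtain a where a: "a \<in> s (Suc k)" "a \<in> s k" using assms(2) by blast
    have "s (Suc k) = ideal_pow P (Suc k) +> a" "s k = ideal_pow P k +> a"
      using a pow.rcoset_memD assms(1)[unfolded adic_quot_def] by blast+
    then show ?thesis
      using ideal_pow_Suc_subset[OF P.is_ideal, of k] by (auto simp: a_r_coset_def')
  qed
  with assms(1) show ?thesis by (simp add: adic_completion_def)
qed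

text \<open>Cosets of one ideal that meet are equal, so an equation in the completion needs only a
  witness at each level.\<close>

lemma C_eqI:
  assumes "s \<in> carrier C" "t \<in> carrier C" "\<And>k. \<exists>a. a \<in> s k \<and> a \<in> t k"
  shows "s = t"
  using assms by (intro ext) (metis C_memD)

lemma C_mem_add:
  "s \<in> carrier C \<Longrightarrow> t \<in> carrier C \<Longrightarrow> a \<in> s k \<Longrightarrow> b \<in> t k \<Longrightarrow> a \<oplus> b \<in> (s \<oplus>\<^bsub>C\<^esub> t) k"
  using pow.rcoset_mem_add[of "s k" k "t k" a b] C_carrier by (simp add: C_ops adic_quot_def)

lemma C_mem_mult:
  "s \<in> carrier C \<Longrightarrow> t \<in> carrier C \<Longrightarrow> a \<in> s k \<Longrightarrow> b \<in> t k \<Longrightarrow> a \<otimes> b \<in> (s \<otimes>\<^bsub>C\<^esub> t) k"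
  using pow.rcoset_mem_mult[of "s k" k "t k" a b] C_carrier by (simp add: C_ops adic_quot_def)

lemma to_C_mem: "a \<in> carrier R \<Longrightarrow> a \<in> to_adic_completion R P a k"
  by (simp add: to_adic_completion_def pow.a_rcos_self)

lemma to_C_closed: "a \<in> carrier R \<Longrightarrow> to_adic_completion R P a \<in> carrier C"
proof (rule C_I)
  fix k assume a: "a \<in> carrier R"
  then show "to_adic_completion R P a k \<in> carrier (adic_quot R P k)"
    by (simp add: to_adic_completion_def adic_quot_def pow.rcoset_in_Quot)
  show "\<exists>x. x \<in> to_adic_completion R P a (Suc k) \<and> x \<in> to_adic_completion R P a k"
    using to_C_mem[OF a] by blast
qed

text \<open>A representative at the higher level \<open>l\<close> is valid at both levels.\<close>

lemma C_common:
  assumes "s \<in> carrier C" "k \<le> l" shows "\<exists>a. a \<in> carrier R \<and> a \<in> s l \<and> a \<in> s k"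
  using C_nonempty[OF assms(1), of l] C_antimono[OF assms] C_memD[OF assms(1)] by blast

lemma C_add_closed:
  assumes "s \<in> carrier C" "t \<in> carrier C" shows "s \<oplus>\<^bsub>C\<^esub> t \<in> carrier C"
proof (rule C_I)
  fix k show "(s \<oplus>\<^bsub>C\<^esub> t) k \<in> carrier (adic_quot R P k)"
    using assms by (simp add: C_ops C_carrier)
  show "\<exists>a. a \<in> (s \<oplus>\<^bsub>C\<^esub> t) (Suc k) \<and> a \<in> (s \<oplus>\<^bsub>C\<^esub> t) k"
    using C_common[OF assms(1), of k "Suc k"] C_common[OF assms(2), of k "Suc k"] C_mem_add[OF assms]
    by (meson le_SucI order_refl)
qed

lemma C_mult_closed:
  assumes "s \<in> carrier C" "t \<in> carrier C" shows "s \<otimes>\<^bsub>C\<^esub> t \<in> carrier C"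
proof (rule C_I)
  fix k show "(s \<otimes>\<^bsub>C\<^esub> t) k \<in> carrier (adic_quot R P k)"
    using assms by (simp add: C_ops C_carrier)
  show "\<exists>a. a \<in> (s \<otimes>\<^bsub>C\<^esub> t) (Suc k) \<and> a \<in> (s \<otimes>\<^bsub>C\<^esub> t) k"
    using C_common[OF assms(1), of k "Suc k"] C_common[OF assms(2), of k "Suc k"] C_mem_mult[OF assms]
    by (meson le_SucI order_refl)
qed

lemma to_C_one: "to_adic_completion R P \<one> = \<one>\<^bsub>C\<^esub>"
  by (rule ext) (simp add: to_adic_completion_def C_ops adic_quot_def FactRing_def)

lemma to_C_zero: "to_adic_completion R P \<zero> = \<zero>\<^bsub>C\<^esub>"
  by (rule ext) (simp add: to_adic_completion_def C_ops adic_quot_def FactRing_def a_rcos_zero[OF pow.is_ideal pow.zero_closed])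

lemma C_has_minus:
  assumes s: "s \<in> carrier C"
  shows "\<exists>t\<in>carrier C. t \<oplus>\<^bsub>C\<^esub> s = \<zero>\<^bsub>C\<^esub>"
proof
  let ?t = "\<lambda>k. \<ominus>\<^bsub>adic_quot R P k\<^esub> s k"
  show "?t \<in> carrier C"
  proof (rule C_I)
    fix k show "?t k \<in> carrier (adic_quot R P k)" using s by (simp add: C_carrier)
    show "\<exists>a. a \<in> ?t (Suc k) \<and> a \<in> ?t k"
      using C_common[OF s, of k "Suc k"] pow.rcoset_mem_minus C_carrier[OF s]
      unfolding adic_quot_def by (meson le_SucI order_refl)
  qed
  show "?t \<oplus>\<^bsub>C\<^esub> s = \<zero>\<^bsub>C\<^esub>"
    using s by (intro ext) (simp add: C_ops C_carrier quot.l_neg)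
qed

text \<open>The ring laws hold componentwise in the quotients; only closure under the operations
  involves the compatibility of sequences.\<close>

lemma C_cring: "cring C"
proof (rule cringI)
  show "abelian_group C"
  proof (rule abelian_groupI)
    show "\<zero>\<^bsub>C\<^esub> \<in> carrier C" using to_C_closed[of \<zero>] by (simp add: to_C_zero)
  qed (auto intro: C_add_closed C_has_minus intro!: ext simp: C_ops C_carrier quot.add.m_ac)
  show "Group.comm_monoid C"
  proof (rule comm_monoidI)
    show "\<one>\<^bsub>C\<^esub> \<in> carrier C" using to_C_closed[of \<one>] by (simp add: to_C_one)
  qed (auto intro: C_mult_closed intro!: ext simp: C_ops C_carrier quot.m_ac)
qed (auto intro!: ext simp: C_ops C_carrier quot.l_distr)

sublocale C: cring C by (rule C_cring)

lemma C_mem_pow: "s \<in> carrier C \<Longrightarrow> a \<in> s k \<Longrightarrow> a [^] n \<in> (s [^]\<^bsub>C\<^esub> (n :: nat)) k"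
proof (induction n)
  case 0
  then show ?case using to_C_mem[of \<one> k] by (simp add: to_C_one)
next
  case (Suc n)
  then show ?case by (simp add: C_mem_mult)
qed

lemma to_C_hom: "ring_hom_cring R C (to_adic_completion R P)"
proof (intro ring_hom_cring.intro ring_hom_cring_axioms.intro is_cring C_cring ring_hom_memI)
  fix x y assume x: "x \<in> carrier R" and y: "y \<in> carrier R"
  note clo = to_C_closed[OF x] to_C_closed[OF y] and mem = to_C_mem[OF x] to_C_mem[OF y]
  show "to_adic_completion R P (x \<otimes> y) = to_adic_completion R P x \<otimes>\<^bsub>C\<^esub> to_adic_completion R P y"
    using to_C_mem[OF m_closed[OF x y]] C_mem_mult[OF clo mem]
    by (intro C_eqI to_C_closed C_mult_closed m_closed x y) blast
  show "to_adic_completion R P (x \<oplus> y) = to_adic_completion R P x \<oplus>\<^bsub>C\<^esub> to_adic_completion R P y"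
    using to_C_mem[OF a_closed[OF x y]] C_mem_add[OF clo mem]
    by (intro C_eqI to_C_closed C_add_closed a_closed x y) blast
qed (auto simp: to_C_closed to_C_one)

text \<open>
  A Cartier map that carries \<open>P\<^sup>c\<^sup>k\<close> into \<open>P\<^sup>k\<close> is continuous for the adic topology; this is its
  extension to the completion.
\<close>

definition completed_map :: "nat \<Rightarrow> ('a \<Rightarrow> 'a) \<Rightarrow> (nat \<Rightarrow> 'a set) \<Rightarrow> nat \<Rightarrow> 'a set"
  where "completed_map c \<psi> s k = ideal_pow P k +> \<psi> (SOME a. a \<in> s (c * k))"

context
  fixes q c \<psi>
  assumes \<psi>: "cartier_map R q \<psi>" and c: "c > 0"
    and continuous: "\<And>x k. x \<in> ideal_pow P (c * k) \<Longrightarrow> \<psi> x \<in> ideal_pow P k"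
begin

text \<open>Two elements of \<open>s (c * k)\<close> differ by an element of \<open>P^(c k)\<close>,
  which \<psi> sends into \<open>P^k\<close>. So the choice made in \<open>completed_map\<close>
  does not affect its value.\<close>

lemma completed_map_mem:
  assumes s: "s \<in> carrier C" and a: "a \<in> s (c * k)"
  shows "\<psi> a \<in> completed_map c \<psi> s k"
proof -
  define b where "b = (SOME a. a \<in> s (c * k))"
  have b: "b \<in> s (c * k)" unfolding b_def using a by (rule someI)
  have carr: "a \<in> carrier R" "b \<in> carrier R" using C_memD[OF s] a b by blast+
  have "ideal_pow P (c * k) +> a = ideal_pow P (c * k) +> b"
    using C_memD[OF s] a b by metis
  then have "a \<ominus> b \<in> ideal_pow P (c * k)"
    using quotient_eq_iff_same_a_r_cos[OF pow.is_ideal carr] by simp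
  then have "\<psi> a \<ominus> \<psi> b \<in> ideal_pow P k"
    using continuous cartier_minus[OF \<psi> carr] by metis
  then have "ideal_pow P k +> \<psi> a = ideal_pow P k +> \<psi> b"
    using quotient_eq_iff_same_a_r_cos[OF pow.is_ideal] carr cartier_mapD(1)[OF \<psi>] by simp
  then show ?thesis
    unfolding completed_map_def b_def[symmetric]
    using pow.a_rcos_self[OF cartier_mapD(1)[OF \<psi> carr(1)], of k] by simp
qed

lemma completed_map_closed:
  assumes s: "s \<in> carrier C" shows "completed_map c \<psi> s \<in> carrier C"
proof (rule C_I)
  fix k
  have "(SOME a. a \<in> s (c * k)) \<in> carrier R"
    using someI_ex[OF C_nonempty[OF s]] C_memD[OF s] by blast
  then show "completed_map c \<psi> s k \<in> carrier (adic_quot R P k)"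
    using cartier_mapD(1)[OF \<psi>] by (simp add: completed_map_def adic_quot_def pow.rcoset_in_Quot)
  \<comment> \<open>A representative of \<open>s\<close> at level \<open>c (k + 1)\<close> also
    represents it at level \<open>c k\<close>, so its image lies in both cosets.\<close>
  show "\<exists>a. a \<in> completed_map c \<psi> s (Suc k) \<and> a \<in> completed_map c \<psi> s k"
    using C_common[OF s, of "c * k" "c * Suc k"] completed_map_mem[OF s]
    by (metis le_add2 mult_Suc_right)
qed

lemma completed_map_to_C:
  assumes x: "x \<in> carrier R"
  shows "completed_map c \<psi> (to_adic_completion R P x) = to_adic_completion R P (\<psi> x)"
proof (rule C_eqI)
  show "\<exists>a. a \<in> completed_map c \<psi> (to_adic_completion R P x) k \<and> a \<in> to_adic_completion R P (\<psi> x) k" for k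
    using completed_map_mem[OF to_C_closed[OF x] to_C_mem[OF x]] to_C_mem[OF cartier_mapD(1)[OF \<psi> x]] by blast
qed (use x cartier_mapD(1)[OF \<psi>] in \<open>auto intro: completed_map_closed to_C_closed\<close>)

lemma cartier_completed_map: "cartier_map C q (completed_map c \<psi>)"
  unfolding cartier_map_def
proof (intro conjI ballI)
  show "completed_map c \<psi> \<in> carrier C \<rightarrow> carrier C" using completed_map_closed by blast
  fix s t assume s: "s \<in> carrier C" and t: "t \<in> carrier C"
  show "completed_map c \<psi> (s \<oplus>\<^bsub>C\<^esub> t) = completed_map c \<psi> s \<oplus>\<^bsub>C\<^esub> completed_map c \<psi> t"
  proof (rule C_eqI)
    fix k
    obtain a b where ab: "a \<in> carrier R" "b \<in> carrier R" "a \<in> s (c * k)" "b \<in> t (c * k)"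
      using C_common[OF s order_refl] C_common[OF t order_refl] by blast
    show "\<exists>x. x \<in> completed_map c \<psi> (s \<oplus>\<^bsub>C\<^esub> t) k \<and> x \<in> (completed_map c \<psi> s \<oplus>\<^bsub>C\<^esub> completed_map c \<psi> t) k"
      using completed_map_mem[OF C.a_closed[OF s t] C_mem_add[OF s t ab(3,4)]]
        C_mem_add[OF completed_map_closed[OF s] completed_map_closed[OF t]
          completed_map_mem[OF s ab(3)] completed_map_mem[OF t ab(4)]]
        cartier_mapD(2)[OF \<psi> ab(1,2)] by auto
  qed (auto intro: completed_map_closed s t)
  show "completed_map c \<psi> (s [^]\<^bsub>C\<^esub> q \<otimes>\<^bsub>C\<^esub> t) = s \<otimes>\<^bsub>C\<^esub> completed_map c \<psi> t"
  proof (rule C_eqI)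
    fix k
    \<comment> \<open>As \<open>c > 0\<close> gives \<open>k \<le> c * k\<close>, the representative
      \<open>a\<close> at level \<open>c k\<close> also represents \<open>s\<close> at level
      \<open>k\<close>, the level at which the factor \<open>s\<close> outside the map is
      evaluated.\<close>
    obtain a b where ab: "a \<in> carrier R" "b \<in> carrier R" "a \<in> s (c * k)" "b \<in> t (c * k)" "a \<in> s k"
      using C_common[OF s, of k "c * k"] C_common[OF t order_refl, of "c * k"] c by auto
    have sq: "s [^]\<^bsub>C\<^esub> q \<in> carrier C" using s by simp
    show "\<exists>x. x \<in> completed_map c \<psi> (s [^]\<^bsub>C\<^esub> q \<otimes>\<^bsub>C\<^esub> t) k \<and> x \<in> (s \<otimes>\<^bsub>C\<^esub> completed_map c \<psi> t) k"
      using completed_map_mem[OF C.m_closed[OF sq t] C_mem_mult[OF sq t C_mem_pow[OF s ab(3)] ab(4)]]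
        C_mem_mult[OF s completed_map_closed[OF t] ab(5) completed_map_mem[OF t ab(4)]]
        cartier_mapD(3)[OF \<psi> ab(1,2)] by auto
  qed (auto intro: completed_map_closed s t)
qed

end

text \<open>Descent is \<open>cartier_frobenius_power\<close> in the completion, applied to the
  continuous extension of \<psi>, which agrees with \<psi> on the image of \<open>R\<close>. Finite
  generation of \<open>P\<close> supplies the continuity.\<close>

lemma is_I_e_completion:
  assumes J: "ideal J R" and fin: "finite Y" "Y \<subseteq> carrier R" "P = Idl Y"
    and split: "\<And>x. x \<in> J \<Longrightarrow> x \<in> frobenius_power R (p ^ e) (cartier_ideal R (p ^ e) J)"
  shows "is_I_e C p e (extend_to_completion R P J) (extend_to_completion R P (cartier_ideal R (p ^ e) J))"
  unfolding extend_to_completion_def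
proof (rule is_I_e_base_change[OF to_C_hom J split])
  fix \<psi> L x
  assume \<psi>: "cartier_map R (p ^ e) \<psi>" and L: "ideal L C" and x: "x \<in> carrier R"
    and mem: "to_adic_completion R P x \<in> frobenius_power C (p ^ e) L"
  have "y [^] (p ^ e) \<in> frobenius_power R (p ^ e) P" if "y \<in> Y" for y
    using pow_in_frobenius_power[OF P.is_ideal] genideal_self[OF fin(2)] that fin(3) by blast
  then obtain c where "ideal_pow P c \<subseteq> frobenius_power R (p ^ e) P"
    using ideal_pow_subset_of_generators[OF fin(1,2) frobenius_power_ideal[OF P.is_ideal]] fin(3) by blast
  \<comment> \<open>Enlarging the exponent makes it positive, as the extension of \<psi>
    requires.\<close>
  then have "ideal_pow P (Suc c) \<subseteq> frobenius_power R (p ^ e) P"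
    using ideal_pow_Suc_subset[OF P.is_ideal] by blast
  then obtain c where "c > 0" and c: "ideal_pow P c \<subseteq> frobenius_power R (p ^ e) P"
    by blast
  note cont = cartier_ideal_pow[OF \<psi> P.is_ideal c]
  show "to_adic_completion R P (\<psi> x) \<in> L"
    using C.cartier_frobenius_power[OF cartier_completed_map[OF \<psi> \<open>c > 0\<close> cont] L mem]
      completed_map_to_C[OF \<psi> \<open>c > 0\<close> cont x] by simp
qed

end

subsection \<open>Localization\<close>

locale localized_ring = cring R + W: submonoid W R for R (structure) and W
begin

abbreviation Q where "Q \<equiv> localization R W"
abbreviation frac where "frac \<equiv> loc_frac R W"

lemma W_carrier [simp]: "s \<in> W \<Longrightarrow> s \<in> carrier R"
  using W.subset by blast

lemma W_closed [simp]: "s \<in> W \<Longrightarrow> t \<in> W \<Longrightarrow> s \<otimes> t \<in> W"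
  by (rule W.m_closed)

lemma W_one [simp]: "\<one> \<in> W"
  by (rule W.one_closed)

lemma W_pow [simp]: "s \<in> W \<Longrightarrow> s [^] (k :: nat) \<in> W"
  by (induction k) auto

text \<open>Without subtraction, equalities of fractions become accessible to the rearrangement of
  products.\<close>

lemma loc_rel_iff:
  "((a, s), (b, t)) \<in> loc_rel R W \<longleftrightarrow> a \<in> carrier R \<and> s \<in> W \<and> b \<in> carrier R \<and> t \<in> W \<and>
    (\<exists>u\<in>W. u \<otimes> (a \<otimes> t) = u \<otimes> (b \<otimes> s))"
proof -
  have "u \<otimes> (a \<otimes> t \<ominus> b \<otimes> s) = \<zero> \<longleftrightarrow> u \<otimes> (a \<otimes> t) = u \<otimes> (b \<otimes> s)"
    if "a \<in> carrier R" "s \<in> W" "b \<in> carrier R" "t \<in> W" "u \<in> W" for u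
  proof -
    have "u \<otimes> (a \<otimes> t \<ominus> b \<otimes> s) = u \<otimes> (a \<otimes> t) \<ominus> u \<otimes> (b \<otimes> s)"
      using that by (simp add: a_minus_def r_distr r_minus)
    then show ?thesis using that by simp
  qed
  then show ?thesis unfolding loc_rel_def by auto
qed

lemma equiv_loc_rel: "equiv (carrier R \<times> W) (loc_rel R W)"
proof (rule equivI)
  show "loc_rel R W \<subseteq> (carrier R \<times> W) \<times> (carrier R \<times> W)"
    by (auto simp: loc_rel_def)
  show "refl_on (carrier R \<times> W) (loc_rel R W)"
    by (auto simp: refl_on_def loc_rel_iff intro: bexI[of _ \<one>])
  show "sym (loc_rel R W)"
    by (auto simp: loc_rel_iff intro!: symI) metis
  show "trans (loc_rel R W)"
  proof (rule transI, clarify)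
    fix a s b t c r
    assume "((a, s), (b, t)) \<in> loc_rel R W" "((b, t), (c, r)) \<in> loc_rel R W"
    then obtain u v where carr: "a \<in> carrier R" "s \<in> W" "b \<in> carrier R" "t \<in> W" "c \<in> carrier R" "r \<in> W"
      and u: "u \<in> W" "u \<otimes> (a \<otimes> t) = u \<otimes> (b \<otimes> s)" and v: "v \<in> W" "v \<otimes> (b \<otimes> r) = v \<otimes> (c \<otimes> t)"
      by (auto simp: loc_rel_iff)
    note [simp] = carr u(1) v(1)
    \<comment> \<open>The middle denominator \<open>t\<close> cannot be cancelled, so it becomes
      part of the witness.\<close>
    have "u \<otimes> v \<otimes> t \<otimes> (a \<otimes> r) = (u \<otimes> (a \<otimes> t)) \<otimes> (v \<otimes> r)" by (simp add: m_ac)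
    also have "\<dots> = (v \<otimes> (b \<otimes> r)) \<otimes> (u \<otimes> s)" by (simp add: u(2)) (simp add: m_ac)
    also have "\<dots> = u \<otimes> v \<otimes> t \<otimes> (c \<otimes> s)" by (simp add: v(2)) (simp add: m_ac)
    finally show "((a, s), (c, r)) \<in> loc_rel R W"
      by (auto simp: loc_rel_iff intro!: bexI[of _ "u \<otimes> v \<otimes> t"])
  qed
qed

lemma frac_eq_iff:
  "a \<in> carrier R \<Longrightarrow> s \<in> W \<Longrightarrow> b \<in> carrier R \<Longrightarrow> t \<in> W \<Longrightarrow>
    frac a s = frac b t \<longleftrightarrow> (\<exists>u\<in>W. u \<otimes> (a \<otimes> t) = u \<otimes> (b \<otimes> s))"
  unfolding loc_frac_def using eq_equiv_class_iff[OF equiv_loc_rel, of "(a, s)" "(b, t)"]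
  by (simp add: loc_rel_iff)

lemma frac_eqI:
  "a \<in> carrier R \<Longrightarrow> s \<in> W \<Longrightarrow> b \<in> carrier R \<Longrightarrow> t \<in> W \<Longrightarrow> a \<otimes> t = b \<otimes> s \<Longrightarrow> frac a s = frac b t"
  by (subst frac_eq_iff) auto

lemma frac_closed [simp]: "a \<in> carrier R \<Longrightarrow> s \<in> W \<Longrightarrow> frac a s \<in> carrier Q"
  by (auto simp: localization_def loc_frac_def intro!: quotientI)

lemma frac_cases:
  assumes "X \<in> carrier Q"
  obtains a s where "a \<in> carrier R" "s \<in> W" "X = frac a s"
  using assms by (auto simp: localization_def loc_frac_def elim!: quotientE)

text \<open>The union over representatives collapses once the product respects
  \<open>loc_rel\<close>; if \<open>u\<close> and \<open>v\<close> witness the two given relations,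
  their product witnesses the new one. \<open>frac_add\<close> follows the same pattern.\<close>

lemma frac_mult:
  assumes "a \<in> carrier R" "s \<in> W" "b \<in> carrier R" "t \<in> W"
  shows "frac a s \<otimes>\<^bsub>Q\<^esub> frac b t = frac (a \<otimes> b) (s \<otimes> t)"
proof -
  have "(\<lambda>(a, s) (b, t). frac (a \<otimes> b) (s \<otimes> t)) respects2 loc_rel R W"
  proof (rule congruent2I', clarify)
    fix a s a' s' b t b' t'
    assume "((a, s), (a', s')) \<in> loc_rel R W" "((b, t), (b', t')) \<in> loc_rel R W"
    then obtain u v where carr: "a \<in> carrier R" "s \<in> W" "a' \<in> carrier R" "s' \<in> W"
        "b \<in> carrier R" "t \<in> W" "b' \<in> carrier R" "t' \<in> W"
      and u: "u \<in> W" "u \<otimes> (a \<otimes> s') = u \<otimes> (a' \<otimes> s)" and v: "v \<in> W" "v \<otimes> (b \<otimes> t') = v \<otimes> (b' \<otimes> t)"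
      by (auto simp: loc_rel_iff)
    note [simp] = carr u(1) v(1)
    have "u \<otimes> v \<otimes> (a \<otimes> b \<otimes> (s' \<otimes> t')) = (u \<otimes> (a \<otimes> s')) \<otimes> (v \<otimes> (b \<otimes> t'))" by (simp add: m_ac)
    also have "\<dots> = u \<otimes> v \<otimes> (a' \<otimes> b' \<otimes> (s \<otimes> t))" unfolding u(2) v(2) by (simp add: m_ac)
    finally show "frac (a \<otimes> b) (s \<otimes> t) = frac (a' \<otimes> b') (s' \<otimes> t')"
      by (auto simp: frac_eq_iff intro!: bexI[of _ "u \<otimes> v"])
  qed
  from UN_equiv_class2[OF equiv_loc_rel equiv_loc_rel this, of "(a, s)" "(b, t)"] assms
  show ?thesis by (simp add: localization_def loc_frac_def split_def)
qed

lemma frac_add: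
  assumes "a \<in> carrier R" "s \<in> W" "b \<in> carrier R" "t \<in> W"
  shows "frac a s \<oplus>\<^bsub>Q\<^esub> frac b t = frac (a \<otimes> t \<oplus> b \<otimes> s) (s \<otimes> t)"
proof -
  have "(\<lambda>(a, s) (b, t). frac (a \<otimes> t \<oplus> b \<otimes> s) (s \<otimes> t)) respects2 loc_rel R W"
  proof (rule congruent2I', clarify)
    fix a s a' s' b t b' t'
    assume "((a, s), (a', s')) \<in> loc_rel R W" "((b, t), (b', t')) \<in> loc_rel R W"
    then obtain u v where carr: "a \<in> carrier R" "s \<in> W" "a' \<in> carrier R" "s' \<in> W"
        "b \<in> carrier R" "t \<in> W" "b' \<in> carrier R" "t' \<in> W"
      and u: "u \<in> W" "u \<otimes> (a \<otimes> s') = u \<otimes> (a' \<otimes> s)" and v: "v \<in> W" "v \<otimes> (b \<otimes> t') = v \<otimes> (b' \<otimes> t)"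
      by (auto simp: loc_rel_iff)
    note [simp] = carr u(1) v(1)
    have "u \<otimes> v \<otimes> ((a \<otimes> t \<oplus> b \<otimes> s) \<otimes> (s' \<otimes> t')) =
        (u \<otimes> (a \<otimes> s')) \<otimes> (v \<otimes> (t \<otimes> t')) \<oplus> (v \<otimes> (b \<otimes> t')) \<otimes> (u \<otimes> (s \<otimes> s'))"
      by (simp add: l_distr r_distr m_ac)
    also have "\<dots> = u \<otimes> v \<otimes> ((a' \<otimes> t' \<oplus> b' \<otimes> s') \<otimes> (s \<otimes> t))"
      unfolding u(2) v(2) by (simp add: l_distr r_distr m_ac)
    finally show "frac (a \<otimes> t \<oplus> b \<otimes> s) (s \<otimes> t) = frac (a' \<otimes> t' \<oplus> b' \<otimes> s') (s' \<otimes> t')"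
      by (auto simp: frac_eq_iff intro!: bexI[of _ "u \<otimes> v"])
  qed
  from UN_equiv_class2[OF equiv_loc_rel equiv_loc_rel this, of "(a, s)" "(b, t)"] assms
  show ?thesis by (simp add: localization_def loc_frac_def split_def)
qed

lemma Q_one: "\<one>\<^bsub>Q\<^esub> = frac \<one> \<one>" and Q_zero: "\<zero>\<^bsub>Q\<^esub> = frac \<zero> \<one>"
  by (simp_all add: localization_def)

lemma Q_cring: "cring Q"
proof (rule cringI)
  show "abelian_group Q"
  proof (rule abelian_groupI)
    fix X Y Z assume "X \<in> carrier Q" "Y \<in> carrier Q" "Z \<in> carrier Q"
    then obtain a s b t c r where [simp]: "a \<in> carrier R" "s \<in> W" "b \<in> carrier R" "t \<in> W" "c \<in> carrier R" "r \<in> W"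
      and "X = frac a s" "Y = frac b t" "Z = frac c r"
      by (metis frac_cases)
    then show "X \<oplus>\<^bsub>Q\<^esub> Y \<oplus>\<^bsub>Q\<^esub> Z = X \<oplus>\<^bsub>Q\<^esub> (Y \<oplus>\<^bsub>Q\<^esub> Z)"
      by (simp add: frac_add) (simp add: l_distr r_distr m_ac a_ac)
  next
    fix X Y assume "X \<in> carrier Q" "Y \<in> carrier Q"
    then obtain a s b t where [simp]: "a \<in> carrier R" "s \<in> W" "b \<in> carrier R" "t \<in> W"
      and XY: "X = frac a s" "Y = frac b t"
      by (metis frac_cases)
    show "X \<oplus>\<^bsub>Q\<^esub> Y \<in> carrier Q" by (simp add: XY frac_add)
    show "X \<oplus>\<^bsub>Q\<^esub> Y = Y \<oplus>\<^bsub>Q\<^esub> X" by (simp add: XY frac_add) (simp add: m_ac a_ac)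
  next
    fix X assume "X \<in> carrier Q"
    then obtain a s where [simp]: "a \<in> carrier R" "s \<in> W" and X: "X = frac a s"
      by (metis frac_cases)
    show "\<zero>\<^bsub>Q\<^esub> \<oplus>\<^bsub>Q\<^esub> X = X" by (simp add: X Q_zero frac_add)
    show "\<exists>Y\<in>carrier Q. Y \<oplus>\<^bsub>Q\<^esub> X = \<zero>\<^bsub>Q\<^esub>"
      by (intro bexI[of _ "frac (\<ominus> a) s"])
        (simp_all add: X Q_zero frac_add l_minus l_neg, rule frac_eqI, simp_all)
  qed (simp add: Q_zero)
  show "Group.comm_monoid Q"
  proof (rule comm_monoidI)
    fix X Y Z assume "X \<in> carrier Q" "Y \<in> carrier Q" "Z \<in> carrier Q"
    then obtain a s b t c r where [simp]: "a \<in> carrier R" "s \<in> W" "b \<in> carrier R" "t \<in> W" "c \<in> carrier R" "r \<in> W"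
      and "X = frac a s" "Y = frac b t" "Z = frac c r"
      by (metis frac_cases)
    then show "X \<otimes>\<^bsub>Q\<^esub> Y \<otimes>\<^bsub>Q\<^esub> Z = X \<otimes>\<^bsub>Q\<^esub> (Y \<otimes>\<^bsub>Q\<^esub> Z)"
      by (simp add: frac_mult) (simp add: m_ac)
  next
    fix X Y assume "X \<in> carrier Q" "Y \<in> carrier Q"
    then obtain a s b t where [simp]: "a \<in> carrier R" "s \<in> W" "b \<in> carrier R" "t \<in> W"
      and XY: "X = frac a s" "Y = frac b t"
      by (metis frac_cases)
    show "X \<otimes>\<^bsub>Q\<^esub> Y \<in> carrier Q" by (simp add: XY frac_mult)
    show "X \<otimes>\<^bsub>Q\<^esub> Y = Y \<otimes>\<^bsub>Q\<^esub> X" by (simp add: XY frac_mult) (simp add: m_ac)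
  next
    fix X assume "X \<in> carrier Q"
    then show "\<one>\<^bsub>Q\<^esub> \<otimes>\<^bsub>Q\<^esub> X = X" by (auto simp: Q_one frac_mult elim!: frac_cases)
  qed (simp add: Q_one)
next
  fix X Y Z assume "X \<in> carrier Q" "Y \<in> carrier Q" "Z \<in> carrier Q"
  then obtain a s b t c r where [simp]: "a \<in> carrier R" "s \<in> W" "b \<in> carrier R" "t \<in> W" "c \<in> carrier R" "r \<in> W"
    and XYZ: "X = frac a s" "Y = frac b t" "Z = frac c r"
    by (metis frac_cases)
  \<comment> \<open>The two sides have denominators \<open>(s t) r\<close> and
    \<open>(s r) (t r)\<close>, so they are compared by cross-multiplication.\<close>
  show "(X \<oplus>\<^bsub>Q\<^esub> Y) \<otimes>\<^bsub>Q\<^esub> Z = X \<otimes>\<^bsub>Q\<^esub> Z \<oplus>\<^bsub>Q\<^esub> Y \<otimes>\<^bsub>Q\<^esub> Z"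
    unfolding XYZ by (simp add: frac_mult frac_add, rule frac_eqI) (simp_all, simp add: l_distr r_distr m_ac)
qed

sublocale Q: cring Q by (rule Q_cring)

lemma frac_pow: "a \<in> carrier R \<Longrightarrow> s \<in> W \<Longrightarrow> frac a s [^]\<^bsub>Q\<^esub> (k :: nat) = frac (a [^] k) (s [^] k)"
  by (induction k) (simp_all add: Q_one frac_mult)

lemma to_Q_hom: "ring_hom_cring R Q (\<lambda>a. frac a \<one>)"
  by (intro ring_hom_cring.intro ring_hom_cring_axioms.intro is_cring Q_cring ring_hom_memI)
    (simp_all add: frac_mult frac_add Q_one)

lemma localize_ideal_ideal:
  assumes "ideal J R" shows "ideal (localize_ideal R W J) Q"
proof (rule Q.cring_idealI)
  interpret J: ideal J R by fact
  note [simp] = J.Icarr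
  show "localize_ideal R W J \<subseteq> carrier Q" by (auto simp: localize_ideal_def)
  show "\<zero>\<^bsub>Q\<^esub> \<in> localize_ideal R W J" by (auto simp: localize_ideal_def Q_zero intro!: exI)
  fix X assume "X \<in> localize_ideal R W J"
  then obtain a s where X: "X = frac a s" "a \<in> J" "s \<in> W" by (auto simp: localize_ideal_def)
  {
    fix Y assume "Y \<in> localize_ideal R W J"
    then obtain b t where Y: "Y = frac b t" "b \<in> J" "t \<in> W" by (auto simp: localize_ideal_def)
    have "a \<otimes> t \<oplus> b \<otimes> s \<in> J" using X Y by (intro J.a_closed J.I_r_closed) auto
    then show "X \<oplus>\<^bsub>Q\<^esub> Y \<in> localize_ideal R W J"
      using X Y unfolding localize_ideal_def by (auto simp: frac_add intro!: exI)
  }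
  fix Y assume "Y \<in> carrier Q"
  then obtain b t where Y: "Y = frac b t" "b \<in> carrier R" "t \<in> W" by (metis frac_cases)
  have "b \<otimes> a \<in> J" using X Y by (intro J.I_l_closed) auto
  then show "Y \<otimes>\<^bsub>Q\<^esub> X \<in> localize_ideal R W J"
    using X Y unfolding localize_ideal_def by (auto simp: frac_mult intro!: exI)
qed

text \<open>As \<open>a / s = (1 / s) (a / 1)\<close>, localized ideals are extended ideals, the
  form that \<open>is_I_e_base_change\<close> expects.\<close>

lemma localize_ideal_eq_genideal:
  assumes "ideal J R" shows "localize_ideal R W J = Idl\<^bsub>Q\<^esub> ((\<lambda>a. frac a \<one>) ` J)"
proof
  have sub: "(\<lambda>a. frac a \<one>) ` J \<subseteq> carrier Q"
    using ideal.Icarr[OF assms] by auto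
  show "Idl\<^bsub>Q\<^esub> ((\<lambda>a. frac a \<one>) ` J) \<subseteq> localize_ideal R W J"
    by (intro Q.genideal_minimal localize_ideal_ideal assms) (use W_one in \<open>unfold localize_ideal_def, blast\<close>)
  show "localize_ideal R W J \<subseteq> Idl\<^bsub>Q\<^esub> ((\<lambda>a. frac a \<one>) ` J)"
  proof
    fix X assume "X \<in> localize_ideal R W J"
    then obtain a s where X: "X = frac a s" "a \<in> J" "s \<in> W" by (auto simp: localize_ideal_def)
    then have "X = frac \<one> s \<otimes>\<^bsub>Q\<^esub> frac a \<one>"
      using ideal.Icarr[OF assms] by (simp add: frac_mult)
    moreover have "frac a \<one> \<in> Idl\<^bsub>Q\<^esub> ((\<lambda>a. frac a \<one>) ` J)"
      using Q.genideal_self[OF sub] X by blast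
    ultimately show "X \<in> Idl\<^bsub>Q\<^esub> ((\<lambda>a. frac a \<one>) ` J)"
      using X by (simp add: ideal.I_l_closed[OF Q.genideal_ideal[OF sub]])
  qed
qed

lemma is_I_e_localization:
  assumes J: "ideal J R"
    and split: "\<And>x. x \<in> J \<Longrightarrow> x \<in> frobenius_power R (p ^ e) (cartier_ideal R (p ^ e) J)"
  shows "is_I_e Q p e (localize_ideal R W J) (localize_ideal R W (cartier_ideal R (p ^ e) J))"
  unfolding localize_ideal_eq_genideal[OF J] localize_ideal_eq_genideal[OF cartier_ideal_ideal[OF J]]
proof (rule is_I_e_base_change[OF to_Q_hom J split])
  fix \<psi> L x
  assume \<psi>: "cartier_map R (p ^ e) \<psi>" and L: "ideal L Q" and x: "x \<in> carrier R"
    and mem: "frac x \<one> \<in> frobenius_power Q (p ^ e) L"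
  interpret hom: ring_hom_cring R Q "\<lambda>a. frac a \<one>" by (rule to_Q_hom)
  interpret L: ideal L Q by (rule L)
  have hom: "ring_hom_ring R Q (\<lambda>a. frac a \<one>)" ..
  define q where "q = p ^ e"
  define M where "M = {a \<in> carrier R. frac a \<one> \<in> L}"
  have M: "ideal M R" unfolding M_def by (rule ring_hom_ring.ideal_vimage[OF hom L])
  interpret F: ideal "frobenius_power R q M" R by (rule frobenius_power_ideal[OF M])
  \<comment> \<open>If \<open>m / s\<close> is in \<open>L\<close>, then
    \<open>m / 1 = (s / 1) (m / s)\<close> is too, so \<open>m\<close> is in the contraction
    \<open>M\<close>. Hence \<open>(m / s)^q\<close> has its numerator \<open>m^q\<close> in the
    Frobenius power of \<open>M\<close>.\<close>
  have "frobenius_power Q q L \<subseteq> localize_ideal R W (frobenius_power R q M)"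
  proof (rule Q.frobenius_power_minimal)
    show "ideal (localize_ideal R W (frobenius_power R q M)) Q"
      by (rule localize_ideal_ideal[OF F.is_ideal])
    fix X assume X: "X \<in> L"
    with L.Icarr obtain m s where m: "m \<in> carrier R" "s \<in> W" "X = frac m s" by (metis frac_cases)
    then have "frac m \<one> = frac s \<one> \<otimes>\<^bsub>Q\<^esub> X"
      by (simp add: frac_mult, intro frac_eqI) (simp_all add: m_ac)
    also have "\<dots> \<in> L" using X m by (intro L.I_l_closed) auto
    finally have "m \<in> M" using m by (simp add: M_def)
    then show "X [^]\<^bsub>Q\<^esub> q \<in> localize_ideal R W (frobenius_power R q M)"
      unfolding m(3) frac_pow[OF m(1,2)] localize_ideal_def
      using pow_in_frobenius_power[OF M, of m q] W_pow[OF m(2), of q] by blast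
  qed
  with mem obtain g s where g: "g \<in> frobenius_power R q M" "s \<in> W" "frac x \<one> = frac g s"
    unfolding q_def localize_ideal_def by blast
  then obtain u where u: "u \<in> W" "u \<otimes> (x \<otimes> s) = u \<otimes> (g \<otimes> \<one>)"
    using frac_eq_iff[of x \<one> g s] x F.Icarr by auto
  define w where "w = u \<otimes> s"
  have w: "w \<in> W" using u g by (simp add: w_def)
  have wx: "w \<otimes> x \<in> frobenius_power R q M"
  proof -
    have "w \<otimes> x = u \<otimes> g" using u g x F.Icarr[OF g(1)] by (simp add: w_def m_ac)
    then show ?thesis using u g by (simp add: F.I_l_closed)
  qed
  \<comment> \<open>Clearing denominators gives one factor \<open>w\<close>; multiplying by
    \<open>w^(q - 1)\<close> completes a \<open>q\<close>-th power, which \<psi> extracts as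
    \<open>w\<close>. If \<open>q = 0\<close>, the Frobenius power contains
    \<open>1\<close>.\<close>
  have "w [^] q \<otimes> x \<in> frobenius_power R q M"
  proof (cases q)
    case 0
    then show ?thesis
      using pow_in_frobenius_power[OF M, of \<zero> q] additive_subgroup.zero_closed[OF ideal.axioms(1)[OF M]]
        F.I_l_closed[of \<one> x] x by simp
  next
    case (Suc k)
    then have "w [^] q \<otimes> x = w [^] k \<otimes> (w \<otimes> x)" using w x by (simp add: m_assoc)
    then show ?thesis using wx w by (simp add: F.I_l_closed)
  qed
  then have "\<psi> (w [^] q \<otimes> x) \<in> M"
    using cartier_frobenius_power[OF \<psi>] M unfolding q_def by blast
  then have "w \<otimes> \<psi> x \<in> M"
    using cartier_mapD(3)[OF \<psi>, of w x] w x by (simp add: q_def)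
  then have "frac \<one> w \<otimes>\<^bsub>Q\<^esub> frac (w \<otimes> \<psi> x) \<one> \<in> L"
    using w by (intro L.I_l_closed) (auto simp: M_def)
  moreover have "frac \<one> w \<otimes>\<^bsub>Q\<^esub> frac (w \<otimes> \<psi> x) \<one> = frac (\<psi> x) \<one>"
    using w cartier_mapD(1)[OF \<psi> x]
    by (subst frac_mult, simp_all, intro frac_eqI) (simp_all add: m_comm)
  ultimately show "frac (\<psi> x) \<one> \<in> L" by simp
qed

end

subsection \<open>The polynomial ring\<close>

lemma mpoly_ring_simps [simp]:
  "f \<in> carrier (mpoly_ring n) \<longleftrightarrow> (\<forall>m\<in>Poly_Mapping.keys f. Poly_Mapping.keys m \<subseteq> {..<n})"
  "f \<otimes>\<^bsub>mpoly_ring n\<^esub> g = f * g" "f \<oplus>\<^bsub>mpoly_ring n\<^esub> g = f + g"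
  "\<one>\<^bsub>mpoly_ring n\<^esub> = 1" "\<zero>\<^bsub>mpoly_ring n\<^esub> = 0"
  by (auto simp: mpoly_ring_def)

lemma cring_mpoly_ring: "cring (mpoly_ring n :: ((nat \<Rightarrow>\<^sub>0 nat) \<Rightarrow>\<^sub>0 'k::comm_ring_1) ring)"
proof (rule cringI)
  show "abelian_group (mpoly_ring n :: ((nat \<Rightarrow>\<^sub>0 nat) \<Rightarrow>\<^sub>0 'k) ring)"
  proof (rule abelian_groupI)
    fix f g :: "(nat \<Rightarrow>\<^sub>0 nat) \<Rightarrow>\<^sub>0 'k"
    assume "f \<in> carrier (mpoly_ring n)" "g \<in> carrier (mpoly_ring n)"
    then show "f \<oplus>\<^bsub>mpoly_ring n\<^esub> g \<in> carrier (mpoly_ring n)"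
      using keys_add[of f g] by (simp, blast)
  next
    fix f :: "(nat \<Rightarrow>\<^sub>0 nat) \<Rightarrow>\<^sub>0 'k"
    assume "f \<in> carrier (mpoly_ring n)"
    then show "\<exists>g\<in>carrier (mpoly_ring n). g \<oplus>\<^bsub>mpoly_ring n\<^esub> f = \<zero>\<^bsub>mpoly_ring n\<^esub>"
      by (intro bexI[of _ "- f"]) (auto simp: in_keys_iff)
  qed (simp_all add: ac_simps)
  show "Group.comm_monoid (mpoly_ring n :: ((nat \<Rightarrow>\<^sub>0 nat) \<Rightarrow>\<^sub>0 'k) ring)"
  proof (rule comm_monoidI)
    fix f g :: "(nat \<Rightarrow>\<^sub>0 nat) \<Rightarrow>\<^sub>0 'k"
    assume *: "f \<in> carrier (mpoly_ring n)" "g \<in> carrier (mpoly_ring n)"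
    have "Poly_Mapping.keys m \<subseteq> {..<n}" if m: "m \<in> Poly_Mapping.keys (f * g)" for m
    proof -
      obtain a b where "m = a + b" "a \<in> Poly_Mapping.keys f" "b \<in> Poly_Mapping.keys g"
        using subsetD[OF keys_mult m] by blast
      then show ?thesis using keys_add[of a b] * by fastforce
    qed
    then show "f \<otimes>\<^bsub>mpoly_ring n\<^esub> g \<in> carrier (mpoly_ring n)" by simp
  qed (simp_all add: ac_simps)
qed (simp add: distrib_right)

lemma mpoly_ring_pow [simp]: "f [^]\<^bsub>mpoly_ring n\<^esub> k = f ^ k"
proof (induction k)
  case 0
  show ?case by (simp add: nat_pow_def)
next
  case (Suc k)
  then show ?case by (simp add: nat_pow_def mult.commute)
qed

lemma ideal_mpoly_sum:
  assumes "ideal I (mpoly_ring n)" "\<And>x. x \<in> X \<Longrightarrow> f x \<in> I"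
  shows "sum f X \<in> I"
  using assms(2)
proof (induction X rule: infinite_finite_induct)
  case (insert x X)
  then show ?case
    using additive_subgroup.a_closed[OF ideal.axioms(1)[OF assms(1)], of "f x" "sum f X"] by simp
qed (use additive_subgroup.zero_closed[OF ideal.axioms(1)[OF assms(1)]] in simp_all)

subsection \<open>The Hilbert basis theorem\<close>

lemma nat_seq_mono_subseq:
  fixes s :: "nat \<Rightarrow> nat"
  shows "\<exists>r :: nat \<Rightarrow> nat. strict_mono r \<and> mono (s \<circ> r)"
proof -
  obtain r where r: "strict_mono r" "monoseq (\<lambda>k. s (r k))"
    using seq_monosub by blast
  show ?thesis
  proof (cases "incseq (\<lambda>k. s (r k))")
    case True
    with r(1) show ?thesis by (auto simp: comp_def)
  next
    case False
    then have dec: "decseq (\<lambda>k. s (r k))" using r(2) by (simp add: monoseq_iff)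
    \<comment> \<open>A decreasing sequence of naturals attains its minimum at some \<open>N\<close>
      and is constant from there on, so its tail is nondecreasing.\<close>
    obtain N where N: "\<And>k. s (r N) \<le> s (r k)"
      using exists_least_iff[of "\<lambda>x. \<exists>k. x = s (r k)"] by (metis not_le_imp_less)
    have "s (r (N + k)) = s (r N)" for k
      using decseqD[OF dec, of N "N + k"] N by (simp add: antisym)
    moreover have "strict_mono (\<lambda>k. r (N + k))"
      using r(1) by (auto simp: strict_mono_def)
    ultimately show ?thesis
      by (intro exI[of _ "\<lambda>k. r (N + k)"]) (simp add: mono_def)
  qed
qed

text \<open>The subsequence is refined once per coordinate; a further subsequence stays monotone in
  the coordinates already treated.\<close>

lemma nat_fun_seq_mono_subseq:
  fixes s :: "nat \<Rightarrow> nat \<Rightarrow> nat"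
  shows "\<exists>r :: nat \<Rightarrow> nat. strict_mono r \<and> (\<forall>v<n. mono (\<lambda>i. s (r i) v))"
proof (induction n)
  case 0
  show ?case by (intro exI[of _ id]) (simp add: strict_mono_def)
next
  case (Suc n)
  then obtain r :: "nat \<Rightarrow> nat" where r: "strict_mono r" "\<And>v. v < n \<Longrightarrow> mono (\<lambda>i. s (r i) v)" by blast
  obtain r' :: "nat \<Rightarrow> nat" where r': "strict_mono r'" "mono (\<lambda>i. s (r (r' i)) n)"
    using nat_seq_mono_subseq[of "\<lambda>i. s (r i) n"] by (auto simp: comp_def)
  have "mono (\<lambda>i. s (r (r' i)) v)" if "v < Suc n" for v
    using that r'(2) monoD[OF r(2)] strict_mono_less_eq[OF r'(1)]
    by (cases "v = n") (auto intro!: monoI)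
  moreover have "strict_mono (\<lambda>i. r (r' i))"
    using r(1) r'(1) by (simp add: strict_mono_def)
  ultimately show ?case by (intro exI[of _ "\<lambda>i. r (r' i)"]) blast
qed

text \<open>Along a subsequence that is nondecreasing in all \<open>n\<close> coordinates, the first
  two terms compare pointwise. In terms of monomials, one divides a later one.\<close>

lemma exponent_seq_good:
  fixes s :: "nat \<Rightarrow> (nat \<Rightarrow>\<^sub>0 nat)"
  assumes "\<And>i. Poly_Mapping.keys (s i) \<subseteq> {..<n}"
  shows "\<exists>i j d. i < j \<and> s j = s i + d"
proof -
  obtain r :: "nat \<Rightarrow> nat" where r: "strict_mono r" "\<And>v. v < n \<Longrightarrow> mono (\<lambda>i. Poly_Mapping.lookup (s (r i)) v)"
    using nat_fun_seq_mono_subseq[of n "\<lambda>i. Poly_Mapping.lookup (s i)"] by blast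
  have "Poly_Mapping.lookup (s (r 0)) v \<le> Poly_Mapping.lookup (s (r 1)) v" for v
  proof (cases "v < n")
    case True
    then show ?thesis using monoD[OF r(2)] by simp
  next
    case False
    then have "v \<notin> Poly_Mapping.keys (s (r 0))" using assms by blast
    then show ?thesis by (simp add: in_keys_iff)
  qed
  then have "s (r 1) = s (r 0) + (s (r 1) - s (r 0))"
    by (intro poly_mapping_eqI) (simp add: lookup_add lookup_minus)
  moreover have "r 0 < r 1" using r(1) by (simp add: strict_mono_def)
  ultimately show ?thesis by blast
qed

text \<open>The order on exponent vectors is lexicographic with smaller indices compared first. It
  serves as the monomial order: \<open>0\<close> is least and addition is monotone.\<close>

lemma exponent_zero_le: "(0 :: nat \<Rightarrow>\<^sub>0 nat) \<le> d"
  by (rule leI) (auto simp: less_poly_mapping.rep_eq less_fun_def)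

lemma exponent_le_add: "(m :: nat \<Rightarrow>\<^sub>0 nat) \<le> m + d"
  using add_left_mono[OF exponent_zero_le[of d], of m] by simp

text \<open>With infinitely many variables the lexicographic order has infinite descending chains,
  hence the bound \<open>n\<close>. Under it, a descending chain would contain
  \<open>s j = s i + d\<close> with \<open>i < j\<close>, which forces
  \<open>s i \<le> s j\<close>.\<close>

lemma wf_exponents:
  "wf {(a, b). a < b \<and> Poly_Mapping.keys a \<subseteq> {..<n} \<and> Poly_Mapping.keys (b :: nat \<Rightarrow>\<^sub>0 nat) \<subseteq> {..<n}}"
    (is "wf ?r")
  unfolding wf_iff_no_infinite_down_chain
proof
  assume "\<exists>s. \<forall>i. (s (Suc i), s i) \<in> ?r"
  then obtain s where "\<forall>i. (s (Suc i), s i) \<in> ?r" by blast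
  then have s: "s (Suc i) < s i" "Poly_Mapping.keys (s i) \<subseteq> {..<n}" for i by auto
  then obtain i j d where "i < j" "s j = s i + d" using exponent_seq_good[of s n] by blast
  moreover have "s j < s i" if "i < j" for i j
    using that s(1) by (induction rule: less_Suc_induct) (auto intro: less_trans)
  ultimately show False using exponent_le_add[of "s i" d] by (metis leD)
qed

text \<open>\<open>B\<close> consists of the elements of \<open>S\<close> that are minimal for
  divisibility. If there were infinitely many, one would divide another by
  \<open>exponent_seq_good\<close>, against minimality.\<close>

lemma dickson_exponents:
  fixes S :: "(nat \<Rightarrow>\<^sub>0 nat) set"
  assumes S: "\<And>m. m \<in> S \<Longrightarrow> Poly_Mapping.keys m \<subseteq> {..<n}"
  shows "\<exists>B\<subseteq>S. finite B \<and> (\<forall>m\<in>S. \<exists>b\<in>B. \<exists>d. m = b + d)"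
proof -
  define B where "B = {m\<in>S. \<forall>m'\<in>S. \<forall>d. m = m' + d \<longrightarrow> m' = m}"
  have "finite B"
  proof (rule ccontr)
    assume "infinite B"
    then obtain s :: "nat \<Rightarrow> nat \<Rightarrow>\<^sub>0 nat" where s: "inj s" "range s \<subseteq> B"
      using infinite_countable_subset by blast
    then obtain i j d where "i < j" "s j = s i + d"
      using exponent_seq_good[of s n] S unfolding B_def by blast
    moreover have "s i \<in> B" "s j \<in> B" using s(2) by auto
    ultimately have "s i = s j" unfolding B_def by blast
    with \<open>i < j\<close> show False using injD[OF s(1)] by blast
  qed
  moreover have "\<exists>b\<in>B. \<exists>d. m = b + d" if m: "m \<in> S" for m
  proof -
    \<comment> \<open>The lexicographically least divisor of \<open>m\<close> in \<open>S\<close> is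
      minimal for divisibility, since each of its own divisors in \<open>S\<close> divides
      \<open>m\<close> and is no larger.\<close>
    let ?X = "{m'\<in>S. \<exists>d. m = m' + d}"
    have "m \<in> ?X" using m by (auto intro: exI[of _ 0])
    from wfE_min[OF wf_exponents[of n] this] obtain b where b: "b \<in> ?X"
      and min: "\<And>y. (y, b) \<in> {(a, b). a < b \<and> Poly_Mapping.keys a \<subseteq> {..<n} \<and> Poly_Mapping.keys b \<subseteq> {..<n}} \<Longrightarrow> y \<notin> ?X"
      by blast
    have "m' = b" if m': "m' \<in> S" "b = m' + d" for m' d
    proof -
      have "m' \<in> ?X" using b m' by (auto simp: add.assoc)
      with min[of m'] have "\<not> m' < b" using S b m' by auto
      moreover have "m' \<le> b" using m'(2) exponent_le_add by simp
      ultimately show ?thesis by simp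
    qed
    with b have "b \<in> B" unfolding B_def by blast
    with b show ?thesis by blast
  qed
  ultimately show ?thesis by (intro exI[of _ B]) (auto simp: B_def)
qed

section \<open>Leading terms and reduction\<close>

lemma leading_term_split:
  fixes f :: "'a::linorder \<Rightarrow>\<^sub>0 'b::ab_group_add"
  assumes "f \<noteq> 0"
  defines "m \<equiv> Max (Poly_Mapping.keys f)"
  obtains g where "f = Poly_Mapping.single m (Poly_Mapping.lookup f m) + g"
    "\<And>k. k \<in> Poly_Mapping.keys g \<Longrightarrow> k < m" "Poly_Mapping.lookup f m \<noteq> 0"
proof
  let ?g = "f - Poly_Mapping.single m (Poly_Mapping.lookup f m)"
  show "f = Poly_Mapping.single m (Poly_Mapping.lookup f m) + ?g" by simp
  have "m \<in> Poly_Mapping.keys f" unfolding m_def using assms(1) by (intro Max_in) auto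
  then show "Poly_Mapping.lookup f m \<noteq> 0" by (simp add: in_keys_iff)
  fix k assume "k \<in> Poly_Mapping.keys ?g"
  then have "k \<noteq> m" "k \<in> Poly_Mapping.keys f"
    by (auto simp: in_keys_iff lookup_minus lookup_single when_def split: if_splits)
  then show "k < m" unfolding m_def using Max_ge[of "Poly_Mapping.keys f" k] by (simp add: less_le)
qed

text \<open>By Dickson's lemma, finitely many elements of \<open>I\<close> have leading monomials
  that divide all leading monomials of \<open>I\<close>. A monomial multiple of one of them cancels
  the leading term of any nonzero \<open>f\<close> in \<open>I\<close>, and well-founded induction
  on the leading monomial finishes.\<close>

lemma noetherian_mpoly_ring: "noetherian_ring (mpoly_ring n :: ((nat \<Rightarrow>\<^sub>0 nat) \<Rightarrow>\<^sub>0 'k::field) ring)"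
proof -
  let ?A = "mpoly_ring n :: ((nat \<Rightarrow>\<^sub>0 nat) \<Rightarrow>\<^sub>0 'k) ring"
  let ?lm = "\<lambda>f :: (nat \<Rightarrow>\<^sub>0 nat) \<Rightarrow>\<^sub>0 'k. Max (Poly_Mapping.keys f)"
  interpret cring ?A by (rule cring_mpoly_ring)
  show ?thesis
  proof (rule noetherian_ringI)
    fix I :: "((nat \<Rightarrow>\<^sub>0 nat) \<Rightarrow>\<^sub>0 'k) set"
    assume I: "ideal I ?A"
    interpret I: ideal I ?A by (rule I)
    have lm_keys: "?lm f \<in> Poly_Mapping.keys f" if "f \<noteq> 0" for f
      using that by (intro Max_in) auto
    have lm_vars: "Poly_Mapping.keys (?lm f) \<subseteq> {..<n}" if "f \<in> I" "f \<noteq> 0" for f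
      using lm_keys[OF that(2)] I.Icarr[OF that(1)] by auto
    have "\<exists>B\<subseteq>?lm ` (I - {0}). finite B \<and> (\<forall>m\<in>?lm ` (I - {0}). \<exists>b\<in>B. \<exists>d. m = b + d)"
    proof (rule dickson_exponents)
      show "Poly_Mapping.keys m \<subseteq> {..<n}" if "m \<in> ?lm ` (I - {0})" for m
        using that lm_vars by (auto simp del: mpoly_ring_simps)
    qed
    then obtain B where B: "B \<subseteq> ?lm ` (I - {0})" "finite B" "\<forall>m\<in>?lm ` (I - {0}). \<exists>b\<in>B. \<exists>d. m = b + d"
      by auto
    then obtain G where G: "G \<subseteq> I - {0}" "finite G" "B = ?lm ` G"
      using finite_subset_image[OF B(2,1)] by blast
    have Gc: "G \<subseteq> carrier ?A" using G(1) I.Icarr by blast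
    interpret IG: ideal "Idl\<^bsub>?A\<^esub> G" ?A by (rule genideal_ideal[OF Gc])
    have "f \<in> Idl\<^bsub>?A\<^esub> G" if "f \<in> I" "f \<noteq> 0" "?lm f = m" for f m
      using wf_exponents[of n] that
    proof (induction m arbitrary: f rule: wf_induct_rule)
      case (less m)
      have "?lm f \<in> ?lm ` (I - {0})" using less.prems by blast
      with B(3) obtain b d where "b \<in> B" "?lm f = b + d" by meson
      with G(3) obtain g where g: "g \<in> G" "?lm f = ?lm g + d" by auto
      have g0: "g \<in> I" "g \<noteq> 0" using g(1) G(1) by auto
      obtain f' where f': "f = Poly_Mapping.single m (Poly_Mapping.lookup f m) + f'"
        "\<And>k. k \<in> Poly_Mapping.keys f' \<Longrightarrow> k < m"
        using leading_term_split[OF less.prems(2)] less.prems(3) by metis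
      obtain g' where g': "g = Poly_Mapping.single (?lm g) (Poly_Mapping.lookup g (?lm g)) + g'"
        "\<And>k. k \<in> Poly_Mapping.keys g' \<Longrightarrow> k < ?lm g" "Poly_Mapping.lookup g (?lm g) \<noteq> 0"
        using leading_term_split[OF g0(2)] by metis
      \<comment> \<open>\<open>c\<close> matches the leading coefficients and \<open>d\<close>
        shifts the leading monomial of \<open>g\<close> to that of \<open>f\<close>, so
        \<open>h = f - t g\<close> has only monomials below \<open>m\<close>.\<close>
      define c where "c = Poly_Mapping.lookup f m / Poly_Mapping.lookup g (?lm g)"
      define t where "t = Poly_Mapping.single d c"
      have d_vars: "Poly_Mapping.keys d \<subseteq> {..<n}"
        using lm_vars[OF less.prems(1,2)] unfolding g(2) by (auto simp: in_keys_iff lookup_add subset_iff)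
      have t: "t \<in> carrier ?A" "- t \<in> carrier ?A" using d_vars by (auto simp: t_def)
      define h where "h = f + (- t) * g"
      have tg: "t * g = Poly_Mapping.single m (Poly_Mapping.lookup f m) + t * g'"
        using g'(3) less.prems(3) g(2)
        by (subst g'(1)) (simp add: distrib_left t_def mult_single c_def add.commute)
      have "h = f' - t * g'" unfolding h_def using f'(1) tg by (simp add: algebra_simps)
      then have keys_h: "Poly_Mapping.keys h \<subseteq> Poly_Mapping.keys f' \<union> Poly_Mapping.keys (t * g')"
        by (simp add: keys_diff)
      have keys_less: "k < m" if "k \<in> Poly_Mapping.keys h" for k
      proof (cases "k \<in> Poly_Mapping.keys f'")
        case False
        then have "k \<in> Poly_Mapping.keys (t * g')" using keys_h that by blast
        then obtain l where "l \<in> Poly_Mapping.keys g'" "k = d + l"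
          using keys_mult[of t g'] by (auto simp: t_def split: if_splits)
        then show ?thesis
          using g'(2)[of l] g(2) less.prems(3) by (simp add: add.commute[of d])
      qed (rule f'(2))
      have hI: "h \<in> I" unfolding h_def
        using I.a_closed[OF less.prems(1) I.I_l_closed[OF g0(1) t(2)]] by simp
      have "h \<in> Idl\<^bsub>?A\<^esub> G"
      proof (cases "h = 0")
        case True
        then show ?thesis using IG.zero_closed by simp
      next
        case False
        then show ?thesis
          using less.IH[OF _ hI False refl] keys_less[OF lm_keys[OF False]] lm_vars[OF hI False]
            lm_vars[OF less.prems(1,2)] less.prems(3) by auto
      qed
      moreover have "f = h + t * g" by (simp add: h_def)
      moreover have "t * g \<in> Idl\<^bsub>?A\<^esub> G"
        using IG.I_l_closed[OF _ t(1), of g] genideal_self[OF Gc] g(1) by auto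
      ultimately show ?case using IG.a_closed[of h "t * g"] by simp
    qed
    then have "I \<subseteq> Idl\<^bsub>?A\<^esub> G" using IG.zero_closed by (metis mpoly_ring_simps(5) subsetI)
    moreover have "Idl\<^bsub>?A\<^esub> G \<subseteq> I" using G(1) by (intro genideal_minimal I) auto
    ultimately show "\<exists>G\<subseteq>carrier ?A. finite G \<and> I = Idl\<^bsub>?A\<^esub> G" using Gc G(2) by blast
  qed
qed

subsection \<open>Coordinates of polynomials over the ring of \<open>q\<close>-th powers\<close>

text \<open>
  The field becomes a vector space over itself when scalars act through the \<open>q\<close>-th power map, so a
  basis over the subfield of \<open>q\<close>-th powers needs no subfield type.
\<close>

lemma field_frobenius_coordinates:
  assumes p: "CHAR('k::field) = p" "p > 0" and q: "q = p ^ e"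
  obtains \<chi> :: "'k::field \<Rightarrow> 'k \<Rightarrow> 'k"
  where "\<And>b u v. \<chi> b (u + v) = \<chi> b u + \<chi> b v"
    and "\<And>b a v. \<chi> b (a ^ q * v) = a * \<chi> b v"
    and "\<And>v. finite {b. \<chi> b v \<noteq> 0}"
    and "\<And>v. (\<Sum>b | \<chi> b v \<noteq> 0. \<chi> b v ^ q * b) = v"
proof -
  have prime: "prime CHAR('k)" using p by (intro prime_CHAR_semidom) simp
  have "(a + b) ^ q = a ^ q + b ^ q" for a b :: 'k
    by (rule freshmans_dream'[OF prime]) (simp add: p q)
  \<comment> \<open>Additivity of the action in the scalar is the freshman's dream.\<close>
  then interpret V: vector_space "\<lambda>a b :: 'k. a ^ q * b"
    by unfold_locales (simp_all add: distrib_left distrib_right power_mult_distrib)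
  define B where "B = V.extend_basis {}"
  have B: "V.independent B" "v \<in> V.span B" for v
    unfolding B_def using V.independent_extend_basis V.span_extend_basis V.independent_empty by auto
  show ?thesis
  \<comment> \<open>Homogeneity for the twisted action is the rule for \<open>a ^ q * v\<close>, so
    no roots have to be extracted.\<close>
  proof (rule that[of "\<lambda>b v. V.representation B v b"])
    show "V.representation B (u + v) b = V.representation B u b + V.representation B v b" for b u v
      using V.representation_add[OF B(1) B(2) B(2)] by simp
    show "V.representation B (a ^ q * v) b = a * V.representation B v b" for a b v
      using V.representation_scale[OF B(1) B(2)] by simp
    show "finite {b. V.representation B v b \<noteq> 0}" for v
      by (rule V.finite_representation)
    show "(\<Sum>b | V.representation B v b \<noteq> 0. V.representation B v b ^ q * b) = v" for v
      by (rule V.sum_nonzero_representation_eq[OF B(1) B(2)])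
  qed
qed

text \<open>The image of a natural number is a constant polynomial and vanishes exactly when its
  coefficient does. This makes the freshman's dream available for polynomials.\<close>

lemma CHAR_poly_mapping: "CHAR('a::comm_monoid_add \<Rightarrow>\<^sub>0 'b::comm_semiring_1) = CHAR('b)"
proof (rule CHAR_eqI)
  have iff: "of_nat k = (0 :: 'a \<Rightarrow>\<^sub>0 'b) \<longleftrightarrow> of_nat k = (0 :: 'b)" for k
  proof
    show "of_nat k = (0 :: 'b)" if "of_nat k = (0 :: 'a \<Rightarrow>\<^sub>0 'b)"
      using arg_cong[OF that, of "\<lambda>f. Poly_Mapping.lookup f 0"] by (simp add: lookup_of_nat)
    show "of_nat k = (0 :: 'a \<Rightarrow>\<^sub>0 'b)" if "of_nat k = (0 :: 'b)"
      using that by (simp flip: single_of_nat)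
  qed
  show "of_nat CHAR('b) = (0 :: 'a \<Rightarrow>\<^sub>0 'b)" by (simp add: iff)
  show "CHAR('b) dvd k" if "of_nat k = (0 :: 'a \<Rightarrow>\<^sub>0 'b)" for k
    using that by (simp add: iff of_nat_eq_0_iff_char_dvd)
qed

lemma poly_mapping_add_induct [case_names zero single add]:
  assumes "P 0" "\<And>m c. P (Poly_Mapping.single m c)" "\<And>f g. P f \<Longrightarrow> P g \<Longrightarrow> P (f + g)"
  shows "P (f :: 'a \<Rightarrow>\<^sub>0 'b::monoid_add)"
proof (induction f rule: Poly_Mapping.update_induct)
  case (update f a b)
  have "Poly_Mapping.update a b f = Poly_Mapping.single a b + f"
    using update(1)
    by (intro poly_mapping_eqI) (auto simp: lookup_update lookup_add lookup_single in_keys_iff when_def)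
  then show ?case using assms(2,3) update by metis
qed (rule assms(1))

lemma poly_mapping_sum_single:
  "(f :: 'a \<Rightarrow>\<^sub>0 'b::comm_monoid_add) = (\<Sum>m\<in>Poly_Mapping.keys f. Poly_Mapping.single m (Poly_Mapping.lookup f m))"
  by (intro poly_mapping_eqI) (auto simp: lookup_sum lookup_single when_def in_keys_iff)

lemma single_power:
  "Poly_Mapping.single m c ^ k = Poly_Mapping.single (of_nat k * m) (c ^ k :: 'b::comm_semiring_1)"
  for m :: "nat \<Rightarrow>\<^sub>0 nat"
  by (induction k) (simp_all add: mult_single distrib_right)

text \<open>Between exponent vectors \<open>*\<close> is itself a convolution product;
  multiplication by \<open>of_nat k\<close> is nevertheless just a \<open>k\<close>-fold
  sum.\<close>

lemma lookup_of_nat_times: "Poly_Mapping.lookup (of_nat k * m) v = k * Poly_Mapping.lookup m v"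
  for m :: "nat \<Rightarrow>\<^sub>0 nat"
  by (induction k) (simp_all add: lookup_add distrib_right)

section \<open>Division of exponent vectors by \<open>q\<close>\<close>

definition exp_div :: "nat \<Rightarrow> (nat \<Rightarrow>\<^sub>0 nat) \<Rightarrow> (nat \<Rightarrow>\<^sub>0 nat)"
  where "exp_div q m = Poly_Mapping.map (\<lambda>x. x div q) m"

definition exp_mod :: "nat \<Rightarrow> (nat \<Rightarrow>\<^sub>0 nat) \<Rightarrow> (nat \<Rightarrow>\<^sub>0 nat)"
  where "exp_mod q m = Poly_Mapping.map (\<lambda>x. x mod q) m"

lemma lookup_exp_div: "Poly_Mapping.lookup (exp_div q m) v = Poly_Mapping.lookup m v div q"
  and lookup_exp_mod: "Poly_Mapping.lookup (exp_mod q m) v = Poly_Mapping.lookup m v mod q"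
  by (auto simp: exp_div_def exp_mod_def map.rep_eq when_def)

lemma exp_decomp: "m = of_nat q * exp_div q m + exp_mod q m"
  by (intro poly_mapping_eqI) (simp add: lookup_add lookup_of_nat_times lookup_exp_div lookup_exp_mod)

text \<open>Euclidean division in each variable: a monomial is in exactly one way a
  \<open>q\<close>-th power times a monomial with all exponents below \<open>q\<close>. This is the
  monomial side of freeness over the \<open>q\<close>-th powers.\<close>

lemma exp_decomp_unique:
  assumes "m = of_nat q * m' + r" "\<And>v. Poly_Mapping.lookup r v < q"
  shows "m' = exp_div q m" "r = exp_mod q m"
proof -
  have "q > 0" using assms(2)[of 0] by linarith
  then show "m' = exp_div q m" "r = exp_mod q m"
    unfolding assms(1) using assms(2)
    by (auto intro!: poly_mapping_eqI simp: lookup_add lookup_of_nat_times lookup_exp_div lookup_exp_mod)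
qed

text \<open>
  The \<open>q\<close>-th root of the coefficient of \<open>f\<close> at the basis element \<open>b x\<^sup>r\<close> of the polynomial ring
  over its subring of \<open>q\<close>-th powers, where \<open>\<chi>\<close> is the coordinate at \<open>b\<close> for the field.
\<close>

definition frobenius_coordinate ::
    "('k::zero \<Rightarrow> 'k) \<Rightarrow> nat \<Rightarrow> (nat \<Rightarrow>\<^sub>0 nat) \<Rightarrow> ((nat \<Rightarrow>\<^sub>0 nat) \<Rightarrow>\<^sub>0 'k) \<Rightarrow> ((nat \<Rightarrow>\<^sub>0 nat) \<Rightarrow>\<^sub>0 'k)"
  where "frobenius_coordinate \<chi> q r f =
    Poly_Mapping.map \<chi> (Poly_Mapping.map_key (\<lambda>m. of_nat q * m + r) f)"

text \<open>Injectivity keeps supports finite when coefficients are reindexed along this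
  map.\<close>

lemma inj_exp_affine: "q > 0 \<Longrightarrow> inj (\<lambda>m :: nat \<Rightarrow>\<^sub>0 nat. of_nat q * m + r)"
  by (rule injI, rule poly_mapping_eqI) (metis add_right_cancel lookup_of_nat_times mult_cancel1 neq0_conv)

context
  fixes \<chi> :: "'k::field \<Rightarrow> 'k" and p q e :: nat
  assumes \<chi>_add: "\<And>u v. \<chi> (u + v) = \<chi> u + \<chi> v"
    and \<chi>_scale: "\<And>a v. \<chi> (a ^ q * v) = a * \<chi> v"
    and p: "CHAR('k) = p" "p > 0" and q: "q = p ^ e"
begin

lemma coordinate_zero: "\<chi> 0 = 0"
  using \<chi>_add[of 0 0] by (metis add.right_neutral add_left_cancel)

lemma q_pos: "q > 0"
  using p(2) q by simp

lemma lookup_frobenius_coordinate: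
  "Poly_Mapping.lookup (frobenius_coordinate \<chi> q r f) m = \<chi> (Poly_Mapping.lookup f (of_nat q * m + r))"
  unfolding frobenius_coordinate_def
  by (simp add: map.rep_eq map_key.rep_eq[OF inj_exp_affine[OF q_pos]] when_def coordinate_zero)

lemma frobenius_coordinate_add:
  "frobenius_coordinate \<chi> q r (f + g) = frobenius_coordinate \<chi> q r f + frobenius_coordinate \<chi> q r g"
  by (intro poly_mapping_eqI) (simp add: lookup_frobenius_coordinate lookup_add \<chi>_add)

lemma frobenius_coordinate_zero: "frobenius_coordinate \<chi> q r 0 = 0"
  by (intro poly_mapping_eqI) (simp add: lookup_frobenius_coordinate coordinate_zero)

lemma frobenius_coordinate_single:
  assumes r: "\<And>v. Poly_Mapping.lookup r v < q"
  shows "frobenius_coordinate \<chi> q r (Poly_Mapping.single m c) =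
    (if exp_mod q m = r then Poly_Mapping.single (exp_div q m) (\<chi> c) else 0)"
proof (rule poly_mapping_eqI)
  fix m'
  have "m = of_nat q * m' + r \<longleftrightarrow> m' = exp_div q m \<and> r = exp_mod q m"
    using exp_decomp_unique[OF _ r] exp_decomp by metis
  then show "Poly_Mapping.lookup (frobenius_coordinate \<chi> q r (Poly_Mapping.single m c)) m' =
    Poly_Mapping.lookup (if exp_mod q m = r then Poly_Mapping.single (exp_div q m) (\<chi> c) else 0) m'"
    by (auto simp: lookup_frobenius_coordinate lookup_single when_def coordinate_zero)
qed

lemma poly_freshmans_dream:
  "(f + g) ^ q = f ^ q + g ^ q" for f g :: "(nat \<Rightarrow>\<^sub>0 nat) \<Rightarrow>\<^sub>0 'k"
proof (rule freshmans_dream')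
  show "prime CHAR((nat \<Rightarrow>\<^sub>0 nat) \<Rightarrow>\<^sub>0 'k)"
    using p unfolding CHAR_poly_mapping by (intro prime_CHAR_semidom) simp
  show "q = CHAR((nat \<Rightarrow>\<^sub>0 nat) \<Rightarrow>\<^sub>0 'k) ^ e"
    unfolding CHAR_poly_mapping by (simp add: p q)
qed

text \<open>Both sides are additive in \<open>f\<close> and, by the freshman's dream, in
  \<open>g\<close>, which reduces the claim to monomials. Multiplying by the \<open>q\<close>-th
  power of a monomial with exponent \<open>m\<close> adds \<open>m\<close> to the quotient of an
  exponent and keeps its remainder.\<close>

lemma frobenius_coordinate_linear:
  assumes r: "\<And>v. Poly_Mapping.lookup r v < q"
  shows "frobenius_coordinate \<chi> q r (g ^ q * f) = g * frobenius_coordinate \<chi> q r f"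
proof (induction g rule: poly_mapping_add_induct)
  case zero
  then show ?case using q_pos by (simp add: power_0_left frobenius_coordinate_zero)
next
  case (add g h)
  then show ?case by (simp add: poly_freshmans_dream distrib_right frobenius_coordinate_add)
next
  case (single m c)
  show ?case
  proof (induction f rule: poly_mapping_add_induct)
    case zero
    then show ?case by (simp add: frobenius_coordinate_zero)
  next
    case (add f h)
    then show ?case by (simp add: distrib_left frobenius_coordinate_add)
  next
    case (single m0 d)
    have "of_nat q * m + m0 = of_nat q * (m + exp_div q m0) + exp_mod q m0"
      by (simp only: distrib_left add.assoc exp_decomp[symmetric])
    moreover have "Poly_Mapping.lookup (exp_mod q m0) v < q" for v
      using q_pos by (simp add: lookup_exp_mod)
    ultimately have "exp_div q (of_nat q * m + m0) = m + exp_div q m0"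
        "exp_mod q (of_nat q * m + m0) = exp_mod q m0"
      by (rule exp_decomp_unique[symmetric])+
    then show ?case
      by (simp only: single_power mult_single frobenius_coordinate_single[OF r] \<chi>_scale
          if_distrib[of "(*) _"] mult_zero_right)
  qed
qed

lemma cartier_frobenius_coordinate:
  assumes r: "\<And>v. Poly_Mapping.lookup r v < q"
  shows "cartier_map (mpoly_ring n) q (frobenius_coordinate \<chi> q r)"
  unfolding cartier_map_def
proof (intro conjI ballI)
  show "frobenius_coordinate \<chi> q r \<in> carrier (mpoly_ring n) \<rightarrow> carrier (mpoly_ring n)"
  proof
    fix f :: "(nat \<Rightarrow>\<^sub>0 nat) \<Rightarrow>\<^sub>0 'k" assume f: "f \<in> carrier (mpoly_ring n)"
    have "Poly_Mapping.keys m \<subseteq> {..<n}" if "m \<in> Poly_Mapping.keys (frobenius_coordinate \<chi> q r f)" for m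
    proof -
      have "of_nat q * m + r \<in> Poly_Mapping.keys f"
        using that by (auto simp: in_keys_iff lookup_frobenius_coordinate coordinate_zero)
      then have "Poly_Mapping.keys (of_nat q * m + r) \<subseteq> {..<n}" using f by simp
      moreover have "Poly_Mapping.keys m \<subseteq> Poly_Mapping.keys (of_nat q * m + r)"
        using q_pos by (auto simp: in_keys_iff lookup_add lookup_of_nat_times)
      ultimately show ?thesis by blast
    qed
    then show "frobenius_coordinate \<chi> q r f \<in> carrier (mpoly_ring n)" by simp
  qed
qed (simp_all add: frobenius_coordinate_add frobenius_coordinate_linear[OF r])

end

text \<open>In the expansion of \<open>f\<close> over the basis elements \<open>b x^r\<close>, the
  coefficients are \<open>q\<close>-th powers of values of Cartier maps on \<open>f\<close>, and
  these values lie in the Cartier ideal.\<close>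

lemma mpoly_frobenius_split:
  fixes f :: "(nat \<Rightarrow>\<^sub>0 nat) \<Rightarrow>\<^sub>0 'k::field"
  assumes p: "CHAR('k) = p" "p > 0" and J: "ideal J (mpoly_ring n)" and f: "f \<in> J"
  shows "f \<in> frobenius_power (mpoly_ring n) (p ^ e) (cartier_ideal (mpoly_ring n) (p ^ e) J)"
proof -
  interpret cring "mpoly_ring n :: ((nat \<Rightarrow>\<^sub>0 nat) \<Rightarrow>\<^sub>0 'k) ring" by (rule cring_mpoly_ring)
  define q where "q = p ^ e"
  have q: "q > 0" using p by (simp add: q_def)
  obtain \<chi> :: "'k \<Rightarrow> 'k \<Rightarrow> 'k" where \<chi>: "\<And>b u v. \<chi> b (u + v) = \<chi> b u + \<chi> b v"
    "\<And>b a v. \<chi> b (a ^ q * v) = a * \<chi> b v" "\<And>v. finite {b. \<chi> b v \<noteq> 0}"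
    "\<And>v. (\<Sum>b | \<chi> b v \<noteq> 0. \<chi> b v ^ q * b) = v"
    using field_frobenius_coordinates[OF p q_def] by blast
  note coord = \<chi>(1,2) p q_def
  let ?c = "\<lambda>b. frobenius_coordinate (\<chi> b) q"
  \<comment> \<open>\<open>B\<close> and \<open>X\<close> are finite index sets that cover every
    basis element occurring in \<open>f\<close>.\<close>
  define B where "B = (\<Union>m\<in>Poly_Mapping.keys f. {b. \<chi> b (Poly_Mapping.lookup f m) \<noteq> 0})"
  define X where "X = exp_mod q ` Poly_Mapping.keys f"
  have fin: "finite B" "finite X" unfolding B_def X_def using \<chi>(3) by auto
  have X: "Poly_Mapping.lookup r v < q" if "r \<in> X" for r v
    using that q by (auto simp: X_def lookup_exp_mod)
  \<comment> \<open>The index sets depend on \<open>f\<close> but not on \<open>g\<close>, so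
    \<open>T\<close> is additive and \<open>T f = f\<close> can be checked on each term of
    \<open>f\<close>.\<close>
  define T where "T = (\<lambda>g. \<Sum>b\<in>B. \<Sum>r\<in>X. ?c b r g ^ q * Poly_Mapping.single r b)"
  have T_add: "T (g + h) = T g + T h" for g h
    by (simp add: T_def frobenius_coordinate_add[OF coord] poly_freshmans_dream[OF coord] distrib_right sum.distrib)
  have T_zero: "T 0 = 0"
    using q by (simp add: T_def frobenius_coordinate_zero[OF coord] power_0_left)
  have T_sum: "T (sum g S) = (\<Sum>s\<in>S. T (g s))" for g and S :: "(nat \<Rightarrow>\<^sub>0 nat) set"
    by (induction S rule: infinite_finite_induct) (simp_all add: T_add T_zero)
  have single_sum: "Poly_Mapping.single m (sum g S) = (\<Sum>s\<in>S. Poly_Mapping.single m (g s))"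
    for m :: "nat \<Rightarrow>\<^sub>0 nat" and g and S :: "'k set"
    by (induction S rule: infinite_finite_induct) (simp_all add: single_add)
  have T_single: "T (Poly_Mapping.single m (Poly_Mapping.lookup f m)) = Poly_Mapping.single m (Poly_Mapping.lookup f m)"
    if m: "m \<in> Poly_Mapping.keys f" for m
  proof -
    let ?a = "Poly_Mapping.lookup f m"
    have mX: "exp_mod q m \<in> X" using m by (simp add: X_def)
    have "(\<Sum>r\<in>X. ?c b r (Poly_Mapping.single m ?a) ^ q * Poly_Mapping.single r b) =
        Poly_Mapping.single m (\<chi> b ?a ^ q * b)" for b
    proof -
      have "(\<Sum>r\<in>X. ?c b r (Poly_Mapping.single m ?a) ^ q * Poly_Mapping.single r b) =
        (\<Sum>r\<in>X. if r = exp_mod q m then Poly_Mapping.single m (\<chi> b ?a ^ q * b) else 0)"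
      proof (rule sum.cong[OF refl])
        fix r assume "r \<in> X"
        then show "?c b r (Poly_Mapping.single m ?a) ^ q * Poly_Mapping.single r b =
          (if r = exp_mod q m then Poly_Mapping.single m (\<chi> b ?a ^ q * b) else 0)"
          using X q exp_decomp[of m q, symmetric]
          by (auto simp: frobenius_coordinate_single[OF coord] single_power mult_single power_0_left)
      qed
      then show ?thesis using fin(2) mX by simp
    qed
    then have "T (Poly_Mapping.single m ?a) = Poly_Mapping.single m (\<Sum>b\<in>B. \<chi> b ?a ^ q * b)"
      by (simp add: T_def single_sum)
    \<comment> \<open>\<open>B\<close> may contain elements whose coordinate is zero for this
      coefficient; their terms vanish because \<open>q > 0\<close>.\<close>
    also have "(\<Sum>b\<in>B. \<chi> b ?a ^ q * b) = (\<Sum>b | \<chi> b ?a \<noteq> 0. \<chi> b ?a ^ q * b)"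
      using fin(1) m q by (intro sum.mono_neutral_right) (auto simp: B_def power_0_left)
    finally show ?thesis using \<chi>(4) by simp
  qed
  have "f = T f"
  proof -
    have "T f = (\<Sum>m\<in>Poly_Mapping.keys f. T (Poly_Mapping.single m (Poly_Mapping.lookup f m)))"
      using T_sum poly_mapping_sum_single[of f] by metis
    also have "\<dots> = f" using T_single poly_mapping_sum_single[of f] by simp
    finally show ?thesis by simp
  qed
  also have "T f \<in> frobenius_power (mpoly_ring n) q (cartier_ideal (mpoly_ring n) q J)"
    unfolding T_def
  proof (intro ideal_mpoly_sum[where n = n] frobenius_power_ideal cartier_ideal_ideal J)
    fix b r assume r: "r \<in> X"
    have I: "ideal (cartier_ideal (mpoly_ring n) q J) (mpoly_ring n)" by (rule cartier_ideal_ideal[OF J])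
    have "?c b r f \<in> cartier_ideal (mpoly_ring n) q J"
      by (intro cartier_in_cartier_ideal J f cartier_frobenius_coordinate[OF coord] X r)
    then have "?c b r f ^ q \<in> frobenius_power (mpoly_ring n) q (cartier_ideal (mpoly_ring n) q J)"
      using pow_in_frobenius_power[OF I, of "?c b r f" q] by simp
    moreover have "Poly_Mapping.single r b \<in> carrier (mpoly_ring n)"
    proof -
      obtain m where m: "m \<in> Poly_Mapping.keys f" "r = exp_mod q m" using r by (auto simp: X_def)
      have "Poly_Mapping.keys m \<subseteq> {..<n}" using ideal.Icarr[OF J f] m(1) by simp
      moreover have "Poly_Mapping.keys r \<subseteq> Poly_Mapping.keys m"
        unfolding m(2) by (auto simp: in_keys_iff lookup_exp_mod intro!: gr0I)
      ultimately show ?thesis by auto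
    qed
    ultimately show "?c b r f ^ q * Poly_Mapping.single r b \<in>
        frobenius_power (mpoly_ring n) q (cartier_ideal (mpoly_ring n) q J)"
      using ideal.I_r_closed[OF frobenius_power_ideal[OF I]] by fastforce
  qed
  finally show ?thesis by (simp add: q_def)
qed

theorem proposition7:
  fixes A :: "((nat \<Rightarrow>\<^sub>0 nat) \<Rightarrow>\<^sub>0 'k::field) ring"
    and n p e :: nat
    and P W J :: "((nat \<Rightarrow>\<^sub>0 nat) \<Rightarrow>\<^sub>0 'k) set"
  assumes "CHAR('k) = p" and "p > 0"
    and "A = mpoly_ring n"
    and "primeideal P A"
    and "submonoid W A"
    and "ideal J A"
  shows "has_I_e A p e J \<and>
    (has_I_e (adic_completion A P) p e (extend_to_completion A P J) \<and>
     I_e (adic_completion A P) p e (extend_to_completion A P J) =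
       extend_to_completion A P (I_e A p e J)) \<and>
    (has_I_e (localization A W) p e (localize_ideal A W J) \<and>
     localize_ideal A W (I_e A p e J) =
       I_e (localization A W) p e (localize_ideal A W J))"
proof -
  interpret A: noetherian_ring A unfolding assms(3) by (rule noetherian_mpoly_ring)
  interpret A: cring A unfolding assms(3) by (rule cring_mpoly_ring)
  have P: "ideal P A" by (rule primeideal.axioms(1)[OF assms(4)])
  interpret completion: adic_ring A P
    by (intro adic_ring.intro A.is_cring P)
  interpret fractions: localized_ring A W
    by (intro localized_ring.intro A.is_cring assms(5))
  have split: "x \<in> frobenius_power A (p ^ e) (cartier_ideal A (p ^ e) J)" if "x \<in> J" for x
    using mpoly_frobenius_split[OF assms(1,2)] assms(3,6) that by blast
  \<comment> \<open>Hilbert's basis theorem yields the finite generating set of \<open>P\<close> on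
    which the extension of Cartier maps to the completion relies.\<close>
  obtain Y where Y: "finite Y" "Y \<subseteq> carrier A" "P = Idl\<^bsub>A\<^esub> Y"
    using A.finetely_gen[OF P] by blast
  note base = I_eI[OF A.is_I_e_cartier_ideal[OF assms(6) split]]
  \<comment> \<open>All three values of \<open>I_e\<close> are expressed through the one ideal
    \<open>cartier_ideal A (p ^ e) J\<close>, so both equalities follow by rewriting.\<close>
  show ?thesis
    using base I_eI[OF completion.is_I_e_completion[OF assms(6) Y split]]
      I_eI[OF fractions.is_I_e_localization[OF assms(6) split]]
    by simp
qed

end
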